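(* Let $n\ge 1$, let $d>0$, let $[a_{ij}]$ be a positive definite symmetric $n\times n$ matrix, let $(\zeta_1,\dots,\zeta_n)\in\mathbb{C}^n$, and let \[\Omega=\Big\{(z_1,\dots,z_n)\in\mathbb{C}^n:\ \sum_{i,j=1}^n a_{ij}(z_i-\zeta_i)\overline{(z_j-\zeta_j)}<d\Big\}.\] Then there exists a $\mathcal{C}^\infty$ smooth positive weight $\omega$ on $\partial\Omega$ such that, for every integer $N\ge 0$, the weighted Szegő projection $S_\omega$ of $\Omega$ satisfies $S_\omega(P_N)=HP_N$.
   Context: Identify $\mathbb{C}^n$ with $\mathbb{R}^{2n}$, writing $z_j=x_j+iy_j$. $P_N$ denotes the space of complex-valued polynomials in $x_1,y_1,\dots,x_n,y_n$ of total degree at most $N$ (not necessarily holomorphic); $HP_N$ denotes the space of holomorphic polynomials $\sum_{|\alpha|\le N}c_\alpha z^\alpha$ of degree at most $N$. For a bounded smooth domain $\Omega\subseteq\mathbb{C}^n$ and a smooth positive function $\omega$ on $\partial\Omega$, the weighted Hardy space $H^2_\omega(\partial\Omega)$ is the closure in $L^2(\partial\Omega,\omega\,d\sigma)$ (with $d\sigma$ surface measure and inner product $\langle f,g\rangle=\int_{\partial\Omega}f\bar g\,\omega\,d\sigma$) of the boundary values of holomorphic functions on $\Omega$ continuous up to $\partial\Omega$; the weighted Szegő projection $S_\omega$ is the orthogonal projection of $L^2(\partial\Omega,\omega\,d\sigma)$ onto $H^2_\omega(\partial\Omega)$. A polynomial is acted on by $S_\omega$ via its restriction to $\partial\Omega$,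 and $S_\omega(P_N)=HP_N$ means that the set of projections of elements of $P_N$ equals the set of boundary values of elements of $HP_N$. *)

theory Defs
  imports "HOL-Analysis.Analysis"
begin

fun C_k :: "nat \<Rightarrow> 'a::euclidean_space set \<Rightarrow> ('a \<Rightarrow> real) \<Rightarrow> bool" where
  "C_k 0 U f = continuous_on U f"
| "C_k (Suc k) U f =
     ((\<forall>x\<in>U. f differentiable (at x)) \<and>
      (\<forall>b\<in>Basis. C_k k U (\<lambda>x. frechet_derivative f (at x) b)))"

definition smooth_on :: "'a::euclidean_space set \<Rightarrow> ('a \<Rightarrow> real) \<Rightarrow> bool" where
  "smooth_on U f \<longleftrightarrow> (\<forall>k. C_k k U f)"

definition smooth_on_set :: "'a::euclidean_space set \<Rightarrow> ('a \<Rightarrow> real) \<Rightarrow> bool" where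
  "smooth_on_set S f \<longleftrightarrow> (\<exists>U g. open U \<and> S \<subseteq> U \<and> smooth_on U g \<and> (\<forall>x\<in>S. g x = f x))"

definition holo_on :: "(complex ^ 'n) set \<Rightarrow> (complex ^ 'n \<Rightarrow> complex) \<Rightarrow> bool" where
  "holo_on U f \<longleftrightarrow>
     (\<forall>z\<in>U. \<exists>L. (f has_derivative L) (at z) \<and> (\<forall>h. L (\<i> *s h) = \<i> * L h))"

definition hausdorff_const :: "real \<Rightarrow> real" where
  "hausdorff_const s = pi powr (s / 2) / (2 powr s * Gamma (s / 2 + 1))"

definition hausdorff_pre :: "real \<Rightarrow> real \<Rightarrow> 'a::euclidean_space set \<Rightarrow> ennreal" where
  "hausdorff_pre s \<delta> A =
     (INF C \<in> {C :: nat \<Rightarrow> 'a set. A \<subseteq> \<Union>(range C) \<and> (\<forall>i. bounded (C i) \<and> diameter (C i) < \<delta>)}.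
        (\<Sum>i. ennreal (hausdorff_const s * diameter (C i) powr s)))"

definition hausdorff_outer :: "real \<Rightarrow> 'a::euclidean_space set \<Rightarrow> ennreal" where
  "hausdorff_outer s A = (SUP \<delta> \<in> {0<..}. hausdorff_pre s \<delta> A)"

definition surface_measure :: "(complex ^ 'n) set \<Rightarrow> (complex ^ 'n) measure" where
  "surface_measure S =
     measure_of S (sets (restrict_space borel S))
       (hausdorff_outer (real (2 * CARD('n)) - 1))"

definition L2w :: "(complex ^ 'n) set \<Rightarrow> (complex ^ 'n \<Rightarrow> real) \<Rightarrow> (complex ^ 'n \<Rightarrow> complex) \<Rightarrow> bool" where
  "L2w S w f \<longleftrightarrow>
     f \<in> borel_measurable (surface_measure S) \<and>
     integrable (surface_measure S) (\<lambda>x. w x * (cmod (f x))\<^sup>2)"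

definition inner_w :: "(complex ^ 'n) set \<Rightarrow> (complex ^ 'n \<Rightarrow> real) \<Rightarrow>
    (complex ^ 'n \<Rightarrow> complex) \<Rightarrow> (complex ^ 'n \<Rightarrow> complex) \<Rightarrow> complex" where
  "inner_w S w f g = (LINT x|surface_measure S. complex_of_real (w x) * f x * cnj (g x))"

definition hardy_space :: "(complex ^ 'n) set \<Rightarrow> (complex ^ 'n \<Rightarrow> real) \<Rightarrow> (complex ^ 'n \<Rightarrow> complex) set" where
  "hardy_space \<Omega> w =
     {h. L2w (frontier \<Omega>) w h \<and>
         (\<exists>F :: nat \<Rightarrow> complex ^ 'n \<Rightarrow> complex.
            (\<forall>k. holo_on \<Omega> (F k) \<and> continuous_on (closure \<Omega>) (F k)) \<and>
            ((\<lambda>k. LINT x|surface_measure (frontier \<Omega>). w x * (cmod (h x - F k x))\<^sup>2) \<longlonglongrightarrow> 0))}"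

text \<open>h represents the weighted Szego projection of f (as an element of L2):
  h lies in the Hardy space and f - h is orthogonal to the Hardy space.\<close>
definition is_szego_proj :: "(complex ^ 'n) set \<Rightarrow> (complex ^ 'n \<Rightarrow> real) \<Rightarrow>
    (complex ^ 'n \<Rightarrow> complex) \<Rightarrow> (complex ^ 'n \<Rightarrow> complex) \<Rightarrow> bool" where
  "is_szego_proj \<Omega> w f h \<longleftrightarrow>
     h \<in> hardy_space \<Omega> w \<and>
     (\<forall>g\<in>hardy_space \<Omega> w. inner_w (frontier \<Omega>) w (\<lambda>x. f x - h x) g = 0)"

definition poly_space :: "nat \<Rightarrow> (complex ^ 'n \<Rightarrow> complex) set" where
  "poly_space N =
     {p. \<exists>c :: ('n \<Rightarrow> nat) \<times> ('n \<Rightarrow> nat) \<Rightarrow> complex.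
        p = (\<lambda>z. \<Sum>(\<alpha>,\<beta>) \<in> {(\<alpha>,\<beta>). (\<Sum>i\<in>UNIV. \<alpha> i + \<beta> i) \<le> N}.
                c (\<alpha>,\<beta>) * (\<Prod>i\<in>UNIV. complex_of_real (Re (z $ i) ^ \<alpha> i * Im (z $ i) ^ \<beta> i)))}"

definition hpoly_space :: "nat \<Rightarrow> (complex ^ 'n \<Rightarrow> complex) set" where
  "hpoly_space N =
     {p. \<exists>c :: ('n \<Rightarrow> nat) \<Rightarrow> complex.
        p = (\<lambda>z. \<Sum>\<alpha> \<in> {\<alpha>. (\<Sum>i\<in>UNIV. \<alpha> i) \<le> N}. c \<alpha> * (\<Prod>i\<in>UNIV. (z $ i) ^ \<alpha> i))}"

text \<open>S_w(P_N) = HP_N, as an equality of subsets of L2 (elements compared a.e.).\<close>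
definition szego_maps_onto :: "(complex ^ 'n) set \<Rightarrow> (complex ^ 'n \<Rightarrow> real) \<Rightarrow> nat \<Rightarrow> bool" where
  "szego_maps_onto \<Omega> w N \<longleftrightarrow>
     (\<forall>p\<in>poly_space N. \<exists>q\<in>hpoly_space N. is_szego_proj \<Omega> w p q) \<and>
     (\<forall>q\<in>hpoly_space N. \<exists>p\<in>poly_space N. is_szego_proj \<Omega> w p q)"

end

theory Submission
  imports Defs "HOL-Complex_Analysis.Cauchy_Integral_Formula"
begin

text \<open>
  The constant weight \<open>1\<close> works. The rotations \<open>z \<mapsto> \<zeta> + l (z - \<zeta>)\<close> with \<open>|l| = 1\<close> are isometries which
  preserve the ellipsoid, hence they preserve the Hausdorff measure on its boundary. Restricted to an
  orbit of this circle action, an element of \<open>P\<^sub>N\<close> has frequencies in \<open>[-N, N]\<close> only, while a homogeneous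
  holomorphic polynomial of degree \<open>k\<close> in \<open>z - \<zeta>\<close> has the single frequency \<open>k\<close>; so \<open>P\<^sub>N\<close> is orthogonal
  to all such polynomials with \<open>k > N\<close>. A holomorphic function continuous up to the boundary is, after
  a small dilation, the uniform limit of its expansion into homogeneous polynomials. Therefore, if \<open>q\<close>
  is the orthogonal projection of \<open>p \<in> P\<^sub>N\<close> onto the finite-dimensional space \<open>HP\<^sub>N\<close>, then \<open>p - q\<close> is
  orthogonal to the whole Hardy space.

  Since \<^const>\<open>measure_of\<close> yields the null measure whenever the given set function is not a measure, the
  countable additivity of Hausdorff measure on Borel sets plays no role; its finiteness on the boundary
  and its invariance under isometries suffice.
\<close>

text \<open>The main obstacle is that \<open>holo_on\<close> only asserts complex differentiability
  at each point, so that the homogeneous components of F are polynomials has to be proved. This is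
  done along complex lines: growth bounds make a component polynomial in each coordinate separately,
  interpolation makes it jointly polynomial, and homogeneity fixes its degree. The dilation is
  forced because a function that is merely continuous up to the boundary may have an expansion that
  diverges there. Averaging is a finite sum over roots of unity, so no exchange of integrals arises.
  The boundary inner product is only treated as semidefinite, since the null measure is not
  excluded; null vectors are therefore handled explicitly in the projection. Finite area, which
  makes continuous functions integrable, comes from counting disjoint balls in a thin shell rather
  than from a parametrization of the boundary.\<close>

no_notation fps_nth (infixl "$" 75)

subsection \<open>Polynomial spaces\<close>

definition lincomb :: "'i set \<Rightarrow> ('i \<Rightarrow> 'z \<Rightarrow> complex) \<Rightarrow> ('z \<Rightarrow> complex) set" where
  "lincomb A m = {p. \<exists>c. p = (\<lambda>z. \<Sum>a\<in>A. c a * m a z)}"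

lemma lincombI: "(\<And>z. p z = (\<Sum>a\<in>A. c a * m a z)) \<Longrightarrow> p \<in> lincomb A m"
  unfolding lincomb_def by blast

lemma lincombE:
  assumes "p \<in> lincomb A m"
  obtains c where "\<And>z. p z = (\<Sum>a\<in>A. c a * m a z)"
  using assms unfolding lincomb_def by auto

lemma lincomb_add:
  assumes "p \<in> lincomb A m" "q \<in> lincomb A m"
  shows "(\<lambda>z. p z + q z) \<in> lincomb A m"
proof -
  obtain c c' where "\<And>z. p z = (\<Sum>a\<in>A. c a * m a z)" "\<And>z. q z = (\<Sum>a\<in>A. c' a * m a z)"
    using assms by (metis lincombE)
  then show ?thesis
    by (intro lincombI[where c = "\<lambda>a. c a + c' a"]) (simp add: sum.distrib algebra_simps)
qed

lemma lincomb_cmult: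
  assumes "p \<in> lincomb A m"
  shows "(\<lambda>z. k * p z) \<in> lincomb A m"
proof -
  obtain c where "\<And>z. p z = (\<Sum>a\<in>A. c a * m a z)"
    using assms by (metis lincombE)
  then show ?thesis
    by (intro lincombI[where c = "\<lambda>a. k * c a"]) (simp add: sum_distrib_left algebra_simps)
qed

lemma lincomb_sum:
  assumes "\<And>i. i \<in> I \<Longrightarrow> f i \<in> lincomb A m"
  shows "(\<lambda>z. \<Sum>i\<in>I. f i z) \<in> lincomb A m"
  using assms
proof (induction I rule: infinite_finite_induct)
  case (insert x F)
  then show ?case
    using lincomb_add[of "f x" A m "\<lambda>z. \<Sum>i\<in>F. f i z"] by simp
qed (auto intro: lincombI[where c = "\<lambda>_. 0"])

lemma lincomb_gen:
  assumes "finite A" "a \<in> A"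
  shows "m a \<in> lincomb A m"
proof (rule lincombI[where c = "\<lambda>b. if b = a then 1 else 0"])
  show "m a z = (\<Sum>b\<in>A. (if b = a then 1 else 0) * m b z)" for z
    using assms by (simp add: if_distrib[where f = "\<lambda>x. x * _"] cong: if_cong)
qed

lemma lincomb_subset:
  assumes "\<And>a. a \<in> A \<Longrightarrow> m a \<in> lincomb B m'"
  shows "lincomb A m \<subseteq> lincomb B m'"
proof
  fix p assume "p \<in> lincomb A m"
  then obtain c where "\<And>z. p z = (\<Sum>a\<in>A. c a * m a z)" by (metis lincombE)
  then have "p = (\<lambda>z. \<Sum>a\<in>A. c a * m a z)" by auto
  then show "p \<in> lincomb B m'"
    using assms by (auto intro!: lincomb_sum lincomb_cmult)
qed

lemma lincomb_mult:
  assumes "\<And>a b. a \<in> A \<Longrightarrow> b \<in> B \<Longrightarrow> (\<lambda>z. m a z * m' b z) \<in> lincomb C m''"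
    and "p \<in> lincomb A m" "q \<in> lincomb B m'"
  shows "(\<lambda>z. p z * q z) \<in> lincomb C m''"
proof -
  obtain c where c: "\<And>z. p z = (\<Sum>a\<in>A. c a * m a z)" using assms(2) by (metis lincombE)
  obtain c' where c': "\<And>z. q z = (\<Sum>b\<in>B. c' b * m' b z)" using assms(3) by (metis lincombE)
  have "(\<lambda>z. p z * q z) = (\<lambda>z. \<Sum>a\<in>A. \<Sum>b\<in>B. (c a * c' b) * (m a z * m' b z))"
    by (simp add: c c' sum_product mult_ac)
  then show ?thesis
    using assms(1) by (auto intro!: lincomb_sum lincomb_cmult)
qed

definition hmono :: "('n \<Rightarrow> nat) \<Rightarrow> complex ^ 'n \<Rightarrow> complex" where
  "hmono \<alpha> z = (\<Prod>i\<in>UNIV. (z $ i) ^ \<alpha> i)"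

definition rmono :: "('n \<Rightarrow> nat) \<times> ('n \<Rightarrow> nat) \<Rightarrow> complex ^ 'n \<Rightarrow> complex" where
  "rmono = (\<lambda>(\<alpha>, \<beta>) z. \<Prod>i\<in>UNIV. complex_of_real (Re (z $ i) ^ \<alpha> i * Im (z $ i) ^ \<beta> i))"

lemma hpoly_space_eq: "hpoly_space N = lincomb {\<alpha>. (\<Sum>i\<in>UNIV. \<alpha> i) \<le> N} hmono"
  unfolding hpoly_space_def lincomb_def hmono_def by simp

lemma poly_space_eq:
  "poly_space N = lincomb {(\<alpha>, \<beta>). (\<Sum>i\<in>UNIV. \<alpha> i + \<beta> i) \<le> N} rmono"
  unfolding poly_space_def lincomb_def rmono_def by (simp add: case_prod_beta)

text \<open>A sum over an infinite index set is 0 by convention, so finiteness is what keeps the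
  polynomial spaces from collapsing to the zero function.\<close>

lemma finite_multiindex: "finite {\<alpha> :: 'n::finite \<Rightarrow> nat. (\<Sum>i\<in>UNIV. \<alpha> i) \<le> N}"
proof (rule finite_subset)
  show "{\<alpha> :: 'n \<Rightarrow> nat. (\<Sum>i\<in>UNIV. \<alpha> i) \<le> N} \<subseteq> PiE UNIV (\<lambda>_. {..N})"
  proof
    fix \<alpha> :: "'n \<Rightarrow> nat" assume "\<alpha> \<in> {\<alpha>. (\<Sum>i\<in>UNIV. \<alpha> i) \<le> N}"
    moreover have "\<alpha> i \<le> (\<Sum>i\<in>UNIV. \<alpha> i)" for i by (rule member_le_sum) auto
    ultimately show "\<alpha> \<in> PiE UNIV (\<lambda>_. {..N})" by (auto intro: order_trans)
  qed
qed (auto intro: finite_PiE)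

lemma finite_multiindex2:
  "finite {(\<alpha>, \<beta>). (\<Sum>i\<in>(UNIV :: 'n::finite set). \<alpha> i + \<beta> i :: nat) \<le> N}"
proof (rule finite_subset)
  show "{(\<alpha>, \<beta>). (\<Sum>i\<in>(UNIV :: 'n set). \<alpha> i + \<beta> i :: nat) \<le> N} \<subseteq>
      {\<alpha>. (\<Sum>i\<in>UNIV. \<alpha> i) \<le> N} \<times> {\<beta>. (\<Sum>i\<in>UNIV. \<beta> i) \<le> N}"
    by (auto simp: sum.distrib)
qed (intro finite_cartesian_product finite_multiindex)

lemma hmono_in_hpoly: "(\<Sum>i\<in>UNIV. \<alpha> i) \<le> N \<Longrightarrow> hmono \<alpha> \<in> hpoly_space N"
  unfolding hpoly_space_eq by (intro lincomb_gen finite_multiindex) simp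

lemma rmono_in_poly: "(\<Sum>i\<in>UNIV. \<alpha> i + \<beta> i) \<le> N \<Longrightarrow> rmono (\<alpha>, \<beta>) \<in> poly_space N"
  unfolding poly_space_eq by (intro lincomb_gen finite_multiindex2) simp

lemma hpoly_mult:
  assumes "p \<in> hpoly_space N" "q \<in> hpoly_space M"
  shows "(\<lambda>z. p z * q z) \<in> hpoly_space (N + M)"
  unfolding hpoly_space_eq
proof (rule lincomb_mult[OF _ assms[unfolded hpoly_space_eq]])
  fix \<alpha> \<beta> :: "'a \<Rightarrow> nat"
  assume *: "\<alpha> \<in> {\<alpha>. sum \<alpha> UNIV \<le> N}" "\<beta> \<in> {\<alpha>. sum \<alpha> UNIV \<le> M}"
  have "(\<lambda>z. hmono \<alpha> z * hmono \<beta> z) = hmono (\<lambda>i. \<alpha> i + \<beta> i)"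
    by (simp add: hmono_def fun_eq_iff power_add prod.distrib)
  moreover have "hmono (\<lambda>i. \<alpha> i + \<beta> i) \<in> hpoly_space (N + M)"
    using * by (intro hmono_in_hpoly) (simp add: sum.distrib)
  ultimately show "(\<lambda>z. hmono \<alpha> z * hmono \<beta> z) \<in> lincomb {\<alpha>. sum \<alpha> UNIV \<le> N + M} hmono"
    unfolding hpoly_space_eq by simp
qed

lemma pspace_mult:
  assumes "p \<in> poly_space N" "q \<in> poly_space M"
  shows "(\<lambda>z. p z * q z) \<in> poly_space (N + M)"
  unfolding poly_space_eq
proof (rule lincomb_mult[OF _ assms[unfolded poly_space_eq]])
  fix a b :: "('a \<Rightarrow> nat) \<times> ('a \<Rightarrow> nat)"
  assume *: "a \<in> {(\<alpha>, \<beta>). (\<Sum>i\<in>UNIV. \<alpha> i + \<beta> i) \<le> N}"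
    "b \<in> {(\<alpha>, \<beta>). (\<Sum>i\<in>UNIV. \<alpha> i + \<beta> i) \<le> M}"
  have "(\<lambda>z. rmono a z * rmono b z) = rmono (\<lambda>i. fst a i + fst b i, \<lambda>i. snd a i + snd b i)"
    by (simp add: rmono_def fun_eq_iff power_add prod.distrib case_prod_beta)
  moreover have "rmono (\<lambda>i. fst a i + fst b i, \<lambda>i. snd a i + snd b i) \<in> poly_space (N + M)"
    using * by (intro rmono_in_poly) (auto simp: sum.distrib)
  ultimately show "(\<lambda>z. rmono a z * rmono b z) \<in>
      lincomb {(\<alpha>, \<beta>). (\<Sum>i\<in>UNIV. \<alpha> i + \<beta> i) \<le> N + M} rmono"
    unfolding poly_space_eq by simp
qed

lemma hpoly_subset:
  assumes "N \<le> M"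
  shows "hpoly_space N \<subseteq> hpoly_space M"
  proof -
  have "hmono \<alpha> \<in> hpoly_space M" if "sum \<alpha> UNIV \<le> N" for \<alpha> :: "'a \<Rightarrow> nat"
    using that assms by (intro hmono_in_hpoly) simp
  then show ?thesis unfolding hpoly_space_eq by (intro lincomb_subset) auto
qed

lemma hpoly_add: "p \<in> hpoly_space N \<Longrightarrow> q \<in> hpoly_space N \<Longrightarrow> (\<lambda>z. p z + q z) \<in> hpoly_space N"
  unfolding hpoly_space_eq by (rule lincomb_add)

lemma hpoly_cmult: "p \<in> hpoly_space N \<Longrightarrow> (\<lambda>z. c * p z) \<in> hpoly_space N"
  unfolding hpoly_space_eq by (rule lincomb_cmult)

lemma hpoly_sum:
  "(\<And>i. i \<in> I \<Longrightarrow> f i \<in> hpoly_space N) \<Longrightarrow> (\<lambda>z. \<Sum>i\<in>I. f i z) \<in> hpoly_space N"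
  unfolding hpoly_space_eq by (rule lincomb_sum)

lemma pspace_add: "p \<in> poly_space N \<Longrightarrow> q \<in> poly_space N \<Longrightarrow> (\<lambda>z. p z + q z) \<in> poly_space N"
  unfolding poly_space_eq by (rule lincomb_add)

lemma pspace_cmult: "p \<in> poly_space N \<Longrightarrow> (\<lambda>z. c * p z) \<in> poly_space N"
  unfolding poly_space_eq by (rule lincomb_cmult)

lemma hpoly_const: "(\<lambda>_. c) \<in> hpoly_space N"
  using hpoly_cmult[OF hmono_in_hpoly[of "\<lambda>_. 0" N], of c] by (simp add: hmono_def)

lemma pspace_const: "(\<lambda>_. c) \<in> poly_space N"
  using pspace_cmult[OF rmono_in_poly[of "\<lambda>_. 0" "\<lambda>_. 0" N], of c] by (simp add: rmono_def)

lemma prod_power_single: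
  "(\<Prod>i\<in>UNIV. f i ^ (if i = j then 1 else 0)) = (f (j :: 'n::finite) :: 'b::comm_semiring_1)"
proof -
  have "(\<Prod>i\<in>UNIV. f i ^ (if i = j then 1 else 0)) = (\<Prod>i\<in>UNIV. if i = j then f i else 1)"
    by (intro prod.cong) auto
  then show ?thesis by simp
qed

lemma hpoly_coord: "(\<lambda>z. z $ j) \<in> hpoly_space 1"
proof -
  have "hmono (\<lambda>i. if i = j then 1 else 0) \<in> hpoly_space 1"
    by (intro hmono_in_hpoly) simp
  then show ?thesis unfolding hmono_def[abs_def] prod_power_single .
qed

lemma pspace_coord: "(\<lambda>z. z $ j) \<in> poly_space 1"
proof -
  let ?e = "\<lambda>i. if i = j then 1 else (0::nat)"
  have "rmono (?e, \<lambda>_. 0) \<in> poly_space 1" "rmono (\<lambda>_. 0, ?e) \<in> poly_space 1"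
    by (intro rmono_in_poly; simp)+
  then have "(\<lambda>z. rmono (?e, \<lambda>_. 0) z + \<i> * rmono (\<lambda>_. 0, ?e) z) \<in> poly_space 1"
    by (intro pspace_add pspace_cmult)
  moreover have "rmono (?e, \<lambda>_. 0) z + \<i> * rmono (\<lambda>_. 0, ?e) z = z $ j" for z
    using prod_power_single[of "\<lambda>i. complex_of_real (Re (z $ i))" j]
      prod_power_single[of "\<lambda>i. complex_of_real (Im (z $ i))" j]
    by (simp add: rmono_def complex_eq[symmetric] del: prod_power_single)
  ultimately show ?thesis by simp
qed

lemma hpoly_power: "p \<in> hpoly_space N \<Longrightarrow> (\<lambda>z. p z ^ k) \<in> hpoly_space (k * N)"
  by (induction k) (auto simp: hpoly_const intro: hpoly_mult)

lemma pspace_power: "p \<in> poly_space N \<Longrightarrow> (\<lambda>z. p z ^ k) \<in> poly_space (k * N)"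
  by (induction k) (auto simp: pspace_const intro: pspace_mult)

lemma hpoly_prod:
  assumes "finite I" "\<And>i. i \<in> I \<Longrightarrow> p i \<in> hpoly_space (N i)"
  shows "(\<lambda>z. \<Prod>i\<in>I. p i z) \<in> hpoly_space (\<Sum>i\<in>I. N i)"
  using assms by (induction I) (auto simp: hpoly_const intro: hpoly_mult)

lemma pspace_prod:
  assumes "finite I" "\<And>i. i \<in> I \<Longrightarrow> p i \<in> poly_space (N i)"
  shows "(\<lambda>z. \<Prod>i\<in>I. p i z) \<in> poly_space (\<Sum>i\<in>I. N i)"
  using assms by (induction I) (auto simp: pspace_const intro: pspace_mult)

lemma pspace_subset:
  assumes "N \<le> M"
  shows "poly_space N \<subseteq> poly_space M"
  proof -
  have "rmono (\<alpha>, \<beta>) \<in> poly_space M" if "(\<Sum>i\<in>UNIV. \<alpha> i + \<beta> i) \<le> N"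
    for \<alpha> \<beta> :: "'a \<Rightarrow> nat"
    using that assms by (intro rmono_in_poly) simp
  then show ?thesis unfolding poly_space_eq by (intro lincomb_subset) auto
qed

lemma hpoly_subset_poly: "hpoly_space N \<subseteq> poly_space N"
  unfolding hpoly_space_eq poly_space_eq
proof (rule lincomb_subset, unfold poly_space_eq[symmetric])
  fix \<alpha> :: "'a \<Rightarrow> nat" assume "\<alpha> \<in> {\<alpha>. sum \<alpha> UNIV \<le> N}"
  moreover have "hmono \<alpha> \<in> poly_space (\<Sum>i\<in>UNIV. \<alpha> i * 1)"
    unfolding hmono_def[abs_def] by (intro pspace_prod pspace_power pspace_coord) auto
  ultimately show "hmono \<alpha> \<in> poly_space N"
    using pspace_subset by fastforce
qed

text \<open>Each factor z_i - \<zeta>_i again has degree at most one, so components of an expansion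
  about \<zeta> stay in \<open>hpoly_space\<close>.\<close>

lemma hpoly_shift:
  assumes "p \<in> hpoly_space N"
  shows "(\<lambda>z. p (z - \<zeta>)) \<in> hpoly_space N"
proof -
  have mono: "(\<lambda>z. hmono \<alpha> (z - \<zeta>)) \<in> hpoly_space N" if "sum \<alpha> UNIV \<le> N" for \<alpha> :: "'a \<Rightarrow> nat"
  proof -
    have "(\<lambda>z. z $ i + - \<zeta> $ i) \<in> hpoly_space 1" for i
      by (intro hpoly_add hpoly_coord hpoly_const)
    then have "(\<lambda>z. \<Prod>i\<in>UNIV. (z $ i + - \<zeta> $ i) ^ \<alpha> i) \<in> hpoly_space (\<Sum>i\<in>UNIV. \<alpha> i * 1)"
      by (intro hpoly_prod hpoly_power) auto
    then show ?thesis
      using hpoly_subset[of "sum \<alpha> UNIV" N] that by (auto simp: hmono_def)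
  qed
  obtain c where "\<And>z. p z = (\<Sum>\<alpha>\<in>{\<alpha>. sum \<alpha> UNIV \<le> N}. c \<alpha> * hmono \<alpha> z)"
    by (rule lincombE[OF assms[unfolded hpoly_space_eq]]) (rule that)
  then show ?thesis
    using mono by (auto intro!: hpoly_sum hpoly_cmult)
qed

section \<open>Interpolation and recognition of polynomials\<close>

lemma hpoly_poly_coord:
  assumes "degree P \<le> k"
  shows "(\<lambda>z. poly P (z $ j)) \<in> hpoly_space k"
proof -
  have "(\<lambda>z. (z $ j) ^ i) \<in> hpoly_space k" if "i \<le> k" for i
    using hpoly_power[OF hpoly_coord[of j], of i] hpoly_subset[of "i * 1" k] that by auto
  then have "(\<lambda>z. \<Sum>i\<le>degree P. coeff P i * (z $ j) ^ i) \<in> hpoly_space k"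
    using assms by (intro hpoly_sum hpoly_cmult) auto
  then show ?thesis by (simp add: poly_altdef)
qed

lemma lagrange_interpolation:
  obtains L :: "nat \<Rightarrow> complex poly" where
    "\<And>m. m \<le> k \<Longrightarrow> degree (L m) \<le> k"
    "\<And>P t. degree P \<le> k \<Longrightarrow> poly P t = (\<Sum>m\<le>k. poly P (of_nat m) * poly (L m) t)"
proof
  define L :: "nat \<Rightarrow> complex poly" where
    "L m = (\<Prod>i\<in>{..k} - {m}. smult (inverse (of_nat m - of_nat i)) [:- of_nat i, 1:])" for m
  show deg: "degree (L m) \<le> k" if "m \<le> k" for m
  proof -
    \<comment> \<open>For m \<le> k the index set has exactly k elements, each giving a factor of
      degree at most one.\<close>
    have "degree (L m) \<le> (\<Sum>i\<in>{..k} - {m}. 1)"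
      unfolding L_def by (rule order.trans[OF degree_prod_sum_le]) (auto intro!: sum_mono)
    then show ?thesis using that by simp
  qed
  have val: "poly (L m) (of_nat j) = (if j = m then 1 else 0)" if "m \<le> k" "j \<le> k" for m j
  proof (cases "j = m")
    case True
    have "poly (L m) (of_nat m) = 1"
      unfolding L_def poly_prod by (intro prod.neutral) (auto simp: divide_simps)
    then show ?thesis using True by simp
  next
    case False
    then show ?thesis using that unfolding L_def poly_prod by (auto intro!: prod_zero)
  qed
  show "poly P t = (\<Sum>m\<le>k. poly P (of_nat m) * poly (L m) t)" if P: "degree P \<le> k" for P t
  proof -
    \<comment> \<open>Both sides have degree at most k and agree at the k + 1 nodes 0, ...,
      k.\<close>
    have "P = (\<Sum>m\<le>k. smult (poly P (of_nat m)) (L m))"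
    proof (rule poly_eqI_degree)
      show "poly P x = poly (\<Sum>m\<le>k. smult (poly P (of_nat m)) (L m)) x"
        if x: "x \<in> of_nat ` {..k}" for x
      proof -
        obtain j where j: "j \<le> k" "x = of_nat j" using x by (elim imageE) simp
        have "poly (\<Sum>m\<le>k. smult (poly P (of_nat m)) (L m)) x =
            (\<Sum>m\<le>k. if j = m then poly P (of_nat m) else 0)"
          unfolding poly_sum using j by (intro sum.cong) (auto simp: val)
        then show ?thesis using j by simp
      qed
      have card: "card ((of_nat :: nat \<Rightarrow> complex) ` {..k}) = Suc k"
        by (subst card_image) (auto simp: inj_on_def)
      show "degree P < card ((of_nat :: nat \<Rightarrow> complex) ` {..k})"
        using P card by simp
      have "degree (\<Sum>m\<le>k. smult (poly P (of_nat m)) (L m)) \<le> k"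
        by (intro degree_sum_le) (auto intro: order.trans[OF degree_smult_le] deg)
      then show "degree (\<Sum>m\<le>k. smult (poly P (of_nat m)) (L m)) <
          card ((of_nat :: nat \<Rightarrow> complex) ` {..k})"
        using card by simp
    qed
    then have "poly P t = poly (\<Sum>m\<le>k. smult (poly P (of_nat m)) (L m)) t" by (rule arg_cong)
    then show ?thesis by (simp add: poly_sum)
  qed
qed

definition upd :: "'a ^ 'n \<Rightarrow> 'n \<Rightarrow> 'a \<Rightarrow> 'a ^ 'n" where
  "upd z j t = (\<chi> i. if i = j then t else z $ i)"

lemma upd_nth [simp]: "upd z j t $ i = (if i = j then t else z $ i)"
  by (simp add: upd_def)

text \<open>At a fixed node in coordinate j, f depends only on the remaining coordinates of J; the
  basis polynomials \<open>L m\<close> put coordinate j back. The bound k is uniform in the base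
  point because the nodes are fixed beforehand. The resulting degree is crude and is corrected later
  by homogeneity.\<close>

lemma separately_polynomial_imp_hpoly:
  fixes f :: "complex ^ 'n \<Rightarrow> complex"
  assumes "finite J"
    and "\<And>z z'. (\<And>i. i \<in> J \<Longrightarrow> z $ i = z' $ i) \<Longrightarrow> f z = f z'"
    and "\<And>z j. \<exists>P. degree P \<le> k \<and> (\<forall>t. f (upd z j t) = poly P t)"
  shows "f \<in> hpoly_space (k * card J)"
  using assms
proof (induction J arbitrary: f rule: finite_induct)
  case empty
  have "f = (\<lambda>_. f 0)" using empty(1) by auto
  then show ?case by (metis hpoly_const)
next
  case (insert j J)
  obtain L :: "nat \<Rightarrow> complex poly" where L: "\<And>m. m \<le> k \<Longrightarrow> degree (L m) \<le> k"
    "\<And>P t. degree P \<le> k \<Longrightarrow> poly P t = (\<Sum>m\<le>k. poly P (of_nat m) * poly (L m) t)"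
    using lagrange_interpolation by metis
  have slice: "(\<lambda>z. f (upd z j s)) \<in> hpoly_space (k * card J)" for s
  proof (rule insert.IH)
    show "f (upd z j s) = f (upd z' j s)" if "\<And>i. i \<in> J \<Longrightarrow> z $ i = z' $ i" for z z'
      using that by (intro insert.prems) auto
    show "\<exists>P. degree P \<le> k \<and> (\<forall>t. f (upd (upd z i t) j s) = poly P t)" for z i
    proof (cases "i = j")
      case True
      then have "f (upd (upd z i t) j s) = poly [:f (upd z j s):] t" for t
        by (auto intro!: arg_cong[of _ _ f] simp: vec_eq_iff)
      then show ?thesis by (intro exI[of _ "[:f (upd z j s):]"]) auto
    next
      case False
      then have "upd (upd z i t) j s = upd (upd z j s) i t" for t
        by (auto simp: vec_eq_iff)
      then show ?thesis using insert.prems(2) by presburger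
    qed
  qed
  have "f = (\<lambda>z. \<Sum>m\<le>k. f (upd z j (of_nat m)) * poly (L m) (z $ j))"
  proof
    fix z
    obtain P where P: "degree P \<le> k" "\<And>t. f (upd z j t) = poly P t"
      using insert.prems(2) by blast
    have "upd z j (z $ j) = z" by (auto simp: vec_eq_iff)
    then show "f z = (\<Sum>m\<le>k. f (upd z j (of_nat m)) * poly (L m) (z $ j))"
      using L(2)[OF P(1), of "z $ j"] P(2)[of "z $ j"] by (simp add: P(2))
  qed
  also have "\<dots> \<in> hpoly_space (k * card J + k)"
  proof (rule hpoly_sum)
    fix m assume "m \<in> {..k}"
    then have "degree (L m) \<le> k" using L(1) by simp
    then show "(\<lambda>z. f (upd z j (of_nat m)) * poly (L m) (z $ j)) \<in> hpoly_space (k * card J + k)"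
      by (rule hpoly_mult[OF slice hpoly_poly_coord])
  qed
  also have "k * card J + k = k * card (insert j J)" using insert.hyps by simp
  finally show ?case .
qed

lemma hmono_scale: "hmono \<alpha> (t *s z) = t ^ (\<Sum>i\<in>UNIV. \<alpha> i) * hmono \<alpha> z"
  by (simp add: hmono_def power_mult_distrib prod.distrib power_sum)

text \<open>Along the line \<open>t *s z\<close> the function is a polynomial in t equal to
  \<open>t ^ k * f z\<close>, so only monomials of total degree k survive.\<close>

lemma homogeneous_hpoly_degree:
  fixes f :: "complex ^ 'n \<Rightarrow> complex"
  assumes f: "f \<in> hpoly_space M" and hom: "\<And>t z. t \<noteq> 0 \<Longrightarrow> f (t *s z) = t ^ k * f z"
  shows "f \<in> hpoly_space k"
proof -
  let ?A = "{\<alpha> :: 'n \<Rightarrow> nat. sum \<alpha> UNIV \<le> M}"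
  obtain c where c: "\<And>z. f z = (\<Sum>\<alpha>\<in>?A. c \<alpha> * hmono \<alpha> z)"
    by (rule lincombE[OF f[unfolded hpoly_space_eq]]) (rule that)
  have fin: "finite ?A" by (rule finite_multiindex)
  have "f z = (\<Sum>\<alpha>\<in>{\<alpha>\<in>?A. sum \<alpha> UNIV = k}. c \<alpha> * hmono \<alpha> z)" for z
  proof -
    define P where "P = (\<Sum>\<alpha>\<in>?A. monom (c \<alpha> * hmono \<alpha> z) (sum \<alpha> UNIV))"
    have "poly P t = poly (monom (f z) k) t" if "t \<noteq> 0" for t
      using hom[OF that, of z] c[of "t *s z"]
      by (simp add: P_def poly_sum poly_monom hmono_scale mult_ac)
    \<comment> \<open>Polynomials in t that agree off 0 agree at infinitely many points, hence are
      equal.\<close>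
    then have "- {0} \<subseteq> {t. poly (P - monom (f z) k) t = 0}" by auto
    moreover have "infinite (- {0 :: complex})"
      by (simp add: Compl_eq_Diff_UNIV infinite_UNIV_char_0)
    ultimately have "P = monom (f z) k"
      using poly_roots_finite[of "P - monom (f z) k"] finite_subset by fastforce
    then have "coeff P k = f z" by simp
    moreover have "coeff P k = (\<Sum>\<alpha>\<in>?A. if sum \<alpha> UNIV = k then c \<alpha> * hmono \<alpha> z else 0)"
      unfolding P_def coeff_sum by (intro sum.cong) auto
    moreover have "\<dots> = (\<Sum>\<alpha>\<in>{\<alpha>\<in>?A. sum \<alpha> UNIV = k}. c \<alpha> * hmono \<alpha> z)"
      by (rule sum.inter_filter[OF fin, symmetric])
    ultimately show ?thesis by simp
  qed
  then have "f = (\<lambda>z. \<Sum>\<alpha>\<in>{\<alpha>\<in>?A. sum \<alpha> UNIV = k}. c \<alpha> * hmono \<alpha> z)" by auto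
  also have "\<dots> \<in> hpoly_space k"
    by (intro hpoly_sum hpoly_cmult hmono_in_hpoly) auto
  finally show ?thesis .
qed

text \<open>On the unit circle \<open>cnj l\<close> is 1/l, so l times the real or imaginary part of
  an affine function of l is a polynomial of degree at most 2. The factor \<open>l ^ N\<close>
  clears all negative powers; degree at most 2N then encodes frequencies in [-N, N].\<close>

lemma poly_space_on_circle:
  fixes r :: "complex ^ 'n \<Rightarrow> complex"
  assumes "r \<in> poly_space N"
  obtains P where "degree P \<le> 2 * N"
    and "\<And>l. cmod l = 1 \<Longrightarrow> l ^ N * r (\<zeta> + l *s w) = poly P l"
proof -
  have trig: "\<exists>P. degree P \<le> 2 \<and> (\<forall>l. cmod l = 1 \<longrightarrow> l * complex_of_real (h (\<zeta> $ i + l * w $ i)) = poly P l)"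
    if h: "h = Re \<or> h = Im" for h i
  proof -
    have cnj_l: "l * cnj l = 1" if "cmod l = 1" for l
      using that by (simp add: complex_norm_square[symmetric])
    have re: "complex_of_real (Re u) = (u + cnj u) / 2" "complex_of_real (Im u) = \<i> * (cnj u - u) / 2" for u
      by (simp_all add: complex_eq_iff)
    show ?thesis
    proof (cases "h = Re")
      case True
      have "l * complex_of_real (Re (\<zeta> $ i + l * w $ i)) =
          poly [:cnj (w $ i) / 2, complex_of_real (Re (\<zeta> $ i)), w $ i / 2:] l" if "cmod l = 1" for l
        using cnj_l[OF that] unfolding re complex_cnj_add complex_cnj_mult by (simp add: field_simps)
      then show ?thesis using True
        by (intro exI[of _ "[:cnj (w $ i) / 2, complex_of_real (Re (\<zeta> $ i)), w $ i / 2:]"]) auto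
    next
      case False
      have "l * complex_of_real (Im (\<zeta> $ i + l * w $ i)) =
          poly [:\<i> * cnj (w $ i) / 2, complex_of_real (Im (\<zeta> $ i)), - \<i> * w $ i / 2:] l" if "cmod l = 1" for l
        using cnj_l[OF that] unfolding re complex_cnj_add complex_cnj_mult by (simp add: field_simps)
      then show ?thesis using False h
        by (intro exI[of _ "[:\<i> * cnj (w $ i) / 2, complex_of_real (Im (\<zeta> $ i)), - \<i> * w $ i / 2:]"]) auto
    qed
  qed
  obtain R where R: "\<And>i. degree (R i) \<le> 2"
    "\<And>i l. cmod l = 1 \<Longrightarrow> l * complex_of_real (Re (\<zeta> $ i + l * w $ i)) = poly (R i) l"
    using trig[of Re] by metis
  obtain I where I: "\<And>i. degree (I i) \<le> 2"
    "\<And>i l. cmod l = 1 \<Longrightarrow> l * complex_of_real (Im (\<zeta> $ i + l * w $ i)) = poly (I i) l"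
    using trig[of Im] by metis
  let ?A = "{(\<alpha>, \<beta>). (\<Sum>i\<in>(UNIV :: 'n set). \<alpha> i + \<beta> i :: nat) \<le> N}"
  obtain c where c: "\<And>z. r z = (\<Sum>a\<in>?A. c a * rmono a z)"
    by (rule lincombE[OF assms[unfolded poly_space_eq]]) (rule that)
  define S where "S a = (\<Sum>i\<in>UNIV. fst a i + snd a i)" for a :: "('n \<Rightarrow> nat) \<times> ('n \<Rightarrow> nat)"
  define m where "m a = (\<Prod>i\<in>UNIV. R i ^ fst a i * I i ^ snd a i)" for a
  \<comment> \<open>A monomial of degree \<open>S a\<close> absorbs only \<open>S a\<close> of the N
    factors l; \<open>monom 1 (N - S a)\<close> supplies the rest, and N - S a + 2 * S a \<le>
    2N.\<close>
  define P where "P = (\<Sum>a\<in>?A. smult (c a) (monom 1 (N - S a) * m a))"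
  have deg_m: "degree (m a) \<le> 2 * S a" for a
  proof -
    have "degree (R i ^ fst a i * I i ^ snd a i) \<le> 2 * (fst a i + snd a i)" for i
    proof -
      have "degree (R i ^ fst a i * I i ^ snd a i) \<le> degree (R i) * fst a i + degree (I i) * snd a i"
        by (rule order.trans[OF degree_mult_le]) (intro add_mono degree_power_le)
      also have "\<dots> \<le> 2 * fst a i + 2 * snd a i"
        using R(1) I(1) by (intro add_mono mult_right_mono) auto
      finally show ?thesis by simp
    qed
    then show ?thesis unfolding m_def S_def sum_distrib_left
      by (intro order.trans[OF degree_prod_sum_le]) (auto intro!: sum_mono)
  qed
  show ?thesis
  proof
    show "degree P \<le> 2 * N"
      unfolding P_def
    proof (rule degree_sum_le[OF finite_multiindex2])
      fix a assume "a \<in> ?A"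
      then have "S a \<le> N" by (auto simp: S_def)
      then have "degree (monom (1::complex) (N - S a) * m a) \<le> 2 * N"
        by (intro order.trans[OF degree_mult_le])
          (use degree_monom_le[of "1::complex" "N - S a"] deg_m[of a] in linarith)
      then show "degree (smult (c a) (monom 1 (N - S a) * m a)) \<le> 2 * N"
        by (meson degree_smult_le order.trans)
    qed
    fix l :: complex assume l: "cmod l = 1"
    have "l ^ N * rmono a (\<zeta> + l *s w) = poly (monom 1 (N - S a) * m a) l" if "a \<in> ?A" for a
    proof -
      have "S a \<le> N" using that by (auto simp: S_def)
      then have "l ^ N = l ^ (N - S a) * (\<Prod>i\<in>UNIV. l ^ fst a i * l ^ snd a i)"
        by (simp add: S_def power_sum[symmetric] power_add[symmetric])
      moreover have "poly (m a) l = (\<Prod>i\<in>UNIV. l ^ fst a i * l ^ snd a i) * rmono a (\<zeta> + l *s w)"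
        unfolding m_def poly_prod rmono_def prod.distrib[symmetric] case_prod_beta
        by (intro prod.cong) (auto simp: R(2)[OF l, symmetric] I(2)[OF l, symmetric] power_mult_distrib)
      ultimately show ?thesis by (simp add: poly_monom)
    qed
    then show "l ^ N * r (\<zeta> + l *s w) = poly P l"
      unfolding c P_def poly_sum sum_distrib_left by (intro sum.cong) (auto simp: mult.left_commute)
  qed
qed

subsection \<open>Hausdorff measure\<close>

lemma diameter_isometry_image:
  fixes f :: "'a::metric_space \<Rightarrow> 'b::metric_space"
  assumes "\<And>x y. dist (f x) (f y) = dist x y"
  shows "diameter (f ` S) = diameter S"
proof -
  have "(\<lambda>(x, y). dist x y) ` (f ` S \<times> f ` S) = (\<lambda>(x, y). dist x y) ` (S \<times> S)"
    using assms by (force simp: image_iff)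
  then show ?thesis by (simp add: diameter_def)
qed

lemma bounded_isometry_image:
  fixes f :: "'a::metric_space \<Rightarrow> 'b::metric_space"
  assumes "\<And>x y. dist (f x) (f y) = dist x y" "bounded S"
  shows "bounded (f ` S)"
proof -
  obtain x e where "\<forall>y\<in>S. dist x y \<le> e" using assms(2) unfolding bounded_def by auto
  then have "\<forall>y\<in>f ` S. dist (f x) y \<le> e" using assms(1) by auto
  then show ?thesis unfolding bounded_def by blast
qed

text \<open>The images of the sets of a cover form a cover of the image with the same
  diameters.\<close>

lemma hausdorff_outer_isometry_le:
  fixes f :: "'a::euclidean_space \<Rightarrow> 'b::euclidean_space"
  assumes f: "\<And>x y. dist (f x) (f y) = dist x y"
  shows "hausdorff_outer s (f ` A) \<le> hausdorff_outer s A"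
proof -
  have "hausdorff_pre s \<delta> (f ` A) \<le> hausdorff_pre s \<delta> A" for \<delta>
    unfolding hausdorff_pre_def[of s \<delta> A]
  proof (rule INF_greatest)
    fix C :: "nat \<Rightarrow> 'a set"
    assume "C \<in> {C. A \<subseteq> \<Union> (range C) \<and> (\<forall>i. bounded (C i) \<and> diameter (C i) < \<delta>)}"
    then have "(\<lambda>i. f ` C i) \<in>
        {C. f ` A \<subseteq> \<Union> (range C) \<and> (\<forall>i. bounded (C i) \<and> diameter (C i) < \<delta>)}"
      using f by (auto simp: diameter_isometry_image bounded_isometry_image image_UN[symmetric]
          simp del: UN_simps)
    then show "hausdorff_pre s \<delta> (f ` A) \<le>
        (\<Sum>i. ennreal (hausdorff_const s * diameter (C i) powr s))"
      unfolding hausdorff_pre_def by (rule INF_lower2) (simp add: diameter_isometry_image f)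
  qed
  then show ?thesis
    unfolding hausdorff_outer_def by (auto intro!: SUP_mono)
qed

lemma hausdorff_outer_isometry:
  fixes f :: "'a::euclidean_space \<Rightarrow> 'b::euclidean_space"
  assumes f: "\<And>x y. dist (f x) (f y) = dist x y" and "surj f"
  shows "hausdorff_outer s (f ` A) = hausdorff_outer s A"
proof (rule antisym)
  have f_inv: "f (inv f y) = y" for y using \<open>surj f\<close> by (rule surj_f_inv_f)
  \<comment> \<open>Both points have the same image, so the isometry puts them at distance
    0.\<close>
  have inv_f: "inv f (f x) = x" for x
    using f[of "inv f (f x)" x] f_inv by simp
  have "dist (inv f x) (inv f y) = dist x y" for x y
    using f[of "inv f x" "inv f y"] f_inv by simp
  then have "hausdorff_outer s (inv f ` f ` A) \<le> hausdorff_outer s (f ` A)"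
    by (rule hausdorff_outer_isometry_le)
  then show "hausdorff_outer s A \<le> hausdorff_outer s (f ` A)"
    by (simp add: image_image inv_f)
qed (rule hausdorff_outer_isometry_le[OF f])

lemma hausdorff_outer_translate:
  fixes A :: "'a::euclidean_space set"
  shows "hausdorff_outer s ((+) c ` A) = hausdorff_outer s A"
  by (rule hausdorff_outer_isometry) auto

lemma hausdorff_outer_mono:
  assumes "A \<subseteq> B"
  shows "hausdorff_outer s A \<le> hausdorff_outer s B"
proof -
  have "hausdorff_pre s \<delta> A \<le> hausdorff_pre s \<delta> B" for \<delta>
    unfolding hausdorff_pre_def using assms by (intro INF_superset_mono) auto
  then show ?thesis
    unfolding hausdorff_outer_def by (auto intro!: SUP_mono)
qed

text \<open>A separated set of largest size is also a net: balls of radius h about its points cover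
  E. The packing bound then controls the sum over this cover uniformly in \<delta>.\<close>

lemma hausdorff_outer_packing_bound:
  fixes E :: "'a::euclidean_space set"
  assumes "0 < s" "0 < h0"
    and pack: "\<And>h T. 0 < h \<Longrightarrow> h < h0 \<Longrightarrow> finite T \<Longrightarrow> T \<subseteq> E \<Longrightarrow>
      (\<And>x y. x \<in> T \<Longrightarrow> y \<in> T \<Longrightarrow> x \<noteq> y \<Longrightarrow> h \<le> dist x y) \<Longrightarrow> real (card T) * h powr s \<le> C"
  shows "hausdorff_outer s E < \<infinity>"
proof -
  have const_nonneg: "0 \<le> hausdorff_const s"
    unfolding hausdorff_const_def using \<open>0 < s\<close>
    by (intro divide_nonneg_nonneg mult_nonneg_nonneg less_imp_le[OF Gamma_real_pos]) auto
  have "hausdorff_pre s \<delta> E \<le> ennreal (hausdorff_const s * 2 powr s * C)" if "0 < \<delta>" for \<delta>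
  proof -
    \<comment> \<open>Half of h0 keeps the packing bound applicable; a quarter of \<delta> keeps the
      diameters 2h strictly below \<delta>.\<close>
    define h where "h = min (h0 / 2) (\<delta> / 4)"
    have h: "0 < h" "h < h0" "2 * h < \<delta>"
      using \<open>0 < h0\<close> \<open>0 < \<delta>\<close> by (auto simp: h_def)
    define sep where "sep T \<longleftrightarrow> finite T \<and> T \<subseteq> E \<and> (\<forall>x\<in>T. \<forall>y\<in>T. x \<noteq> y \<longrightarrow> h \<le> dist x y)" for T
    have sep_card: "real (card T) * h powr s \<le> C" if "sep T" for T
      using that h pack[of h T] by (auto simp: sep_def)
    \<comment> \<open>A common cap on the size of separated sets guarantees one of maximal
      size.\<close>
    have "card T < Suc (nat \<lceil>C / h powr s\<rceil>)" if "sep T" for T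
    proof -
      have "real (card T) \<le> C / h powr s"
        using sep_card[OF that] h by (simp add: field_simps)
      then show ?thesis by linarith
    qed
    moreover have "sep {}" by (simp add: sep_def)
    ultimately obtain T where T: "sep T" "\<And>T'. sep T' \<Longrightarrow> card T' \<le> card T"
      using ex_has_greatest_nat[of sep "{}" card] by blast
    have cover: "\<exists>x\<in>T. dist x y < h" if "y \<in> E" for y
    proof (rule ccontr)
      assume *: "\<not> ?thesis"
      then have "sep (insert y T)"
        using T(1) that by (auto simp: sep_def dist_commute)
      moreover have "y \<notin> T" using * h by force
      ultimately show False using T(2)[of "insert y T"] T(1) by (simp add: sep_def)
    qed
    obtain t where t: "bij_betw t {..<card T} T"
      using T(1) ex_bij_betw_nat_finite[of T] by (auto simp: sep_def atLeast0LessThan)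
    \<comment> \<open>Covers are infinite sequences, so the balls are padded with empty sets, which
      contribute 0.\<close>
    define B where "B i = (if i < card T then ball (t i) h else {})" for i
    have "E \<subseteq> \<Union> (range B)"
    proof
      fix y assume "y \<in> E"
      then obtain x where "x \<in> T" "dist x y < h" using cover by auto
      moreover have "x \<in> t ` {..<card T}" using t \<open>x \<in> T\<close> by (simp add: bij_betw_def)
      then obtain i where "i < card T" "t i = x" by auto
      ultimately show "y \<in> \<Union> (range B)" by (auto simp: B_def intro!: exI[of _ i])
    qed
    moreover have "bounded (B i) \<and> diameter (B i) < \<delta>" for i
      using h \<open>0 < \<delta>\<close> by (auto simp: B_def)
    ultimately have "hausdorff_pre s \<delta> E \<le> (\<Sum>i. ennreal (hausdorff_const s * diameter (B i) powr s))"
      unfolding hausdorff_pre_def by (intro INF_lower) auto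
    also have "\<dots> = (\<Sum>i<card T. ennreal (hausdorff_const s * diameter (B i) powr s))"
      by (rule suminf_finite) (auto simp: B_def)
    also have "\<dots> = (\<Sum>i<card T. ennreal (hausdorff_const s * (2 * h) powr s))"
      using h by (intro sum.cong) (auto simp: B_def)
    also have "\<dots> = ennreal (hausdorff_const s * 2 powr s * (card T * h powr s))"
      using const_nonneg h
      by (simp add: powr_mult ennreal_mult' ennreal_of_nat_eq_real_of_nat mult_ac)
    also have "\<dots> \<le> ennreal (hausdorff_const s * 2 powr s * C)"
      using const_nonneg sep_card[OF T(1)] by (intro ennreal_leI mult_left_mono) auto
    finally show ?thesis .
  qed
  then have "hausdorff_outer s E \<le> ennreal (hausdorff_const s * 2 powr s * C)"
    unfolding hausdorff_outer_def by (intro SUP_least) auto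
  also have "\<dots> < \<infinity>" by simp
  finally show ?thesis .
qed

lemma measure_lebesgue_scaling:
  fixes S :: "'a::euclidean_space set"
  assumes "0 \<le> c"
  shows "measure lebesgue ((*\<^sub>R) c ` S) = c ^ DIM('a) * measure lebesgue S"
  using measure_lebesgue_affine[of c 0 S] assms by simp

text \<open>The balls of radius \<open>h/2\<close> around the points of an \<open>h\<close>-separated subset of the level set are disjoint
  and lie in the shell \<open>|Q - d| < K h\<close>, whose volume is \<open>O(h)\<close> by homogeneity of \<open>Q\<close>.\<close>
lemma hausdorff_outer_homogeneous_level_set_finite:
  fixes Q :: "complex ^ 'n \<Rightarrow> real"
  assumes "0 < d" and cont: "continuous_on UNIV Q" and bdd: "bounded {x. Q x \<le> d}"
    and hom: "\<And>c x. Q (c *\<^sub>R x) = c\<^sup>2 * Q x"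
    and lip: "\<And>x y. Q x = d \<Longrightarrow> norm (y - x) \<le> 1 \<Longrightarrow> \<bar>Q y - d\<bar> \<le> K * norm (y - x)" and "0 < K"
  shows "hausdorff_outer (real (2 * CARD('n)) - 1) {x. Q x = d} < \<infinity>"
proof -
  let ?n = "CARD('n)" and ?\<mu> = "measure (lebesgue :: (complex ^ 'n) measure)"
  define S where "S c = {x. Q x \<le> c}" for c
  define V where "V = ?\<mu> (S d)"
  define B where "B = measure lborel (ball (0 :: complex ^ 'n) 1)"
  have dim: "DIM(complex ^ 'n) = 2 * ?n" by simp
  have "0 < B" unfolding B_def by (rule content_ball_pos) simp
  have S_scale: "S (r\<^sup>2 * d) = (*\<^sub>R) r ` S d" if "0 < r" for r
  proof -
    have "x \<in> (*\<^sub>R) r ` S d" if "Q x \<le> r\<^sup>2 * d" for x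
    proof (rule image_eqI)
      have "r\<^sup>2 * Q (inverse r *\<^sub>R x) \<le> r\<^sup>2 * d"
        using that \<open>0 < r\<close> hom[of r "inverse r *\<^sub>R x"] by simp
      then show "inverse r *\<^sub>R x \<in> S d" using \<open>0 < r\<close> by (simp add: S_def)
    qed (use \<open>0 < r\<close> in simp)
    then show ?thesis using that by (auto simp: S_def hom)
  qed
  have closed_S: "closed (S c)" for c
    unfolding S_def using cont by (intro closed_Collect_le) auto
  have compact_S: "compact (S (r\<^sup>2 * d))" if "0 < r" for r
    using closed_S bdd that S_scale
    by (metis S_def compact_eq_bounded_closed bounded_scaling)
  \<comment> \<open>The sublevel set at u * d is the dilate by \<open>sqrt u\<close>, so in real
    dimension 2n its volume scales by u^n.\<close>
  have S_meas: "S (u * d) \<in> lmeasurable" "?\<mu> (S (u * d)) = u ^ ?n * V" if "0 < u" for u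
  proof -
    have u: "u = (sqrt u)\<^sup>2" "0 < sqrt u" using that by auto
    show "S (u * d) \<in> lmeasurable"
      using compact_S[OF u(2)] u(1) by (simp add: lmeasurable_compact)
    have "?\<mu> (S (u * d)) = sqrt u ^ (2 * ?n) * V"
      using S_scale[OF u(2)] u measure_lebesgue_scaling[of "sqrt u" "S d"] dim
      by (simp add: V_def mult.commute)
    then show "?\<mu> (S (u * d)) = u ^ ?n * V"
      using u by (simp add: power_mult)
  qed
  have "0 \<le> V" by (simp add: V_def)
  show ?thesis
  proof (rule hausdorff_outer_packing_bound)
    have "0 < ?n" by simp
    then show "0 < real (2 * ?n) - 1" by linarith
    \<comment> \<open>The bound 1 keeps the small balls within reach of \<open>lip\<close>; the
      bound d / (2 * K) keeps u = K * h / d below 1, so that both levels (1 + u) * d and (1 - u) * d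
      are positive.\<close>
    show "0 < min 1 (d / (2 * K))" using \<open>0 < K\<close> \<open>0 < d\<close> by simp
    fix h T assume h: "0 < h" "h < min 1 (d / (2 * K))" and T: "finite T" "T \<subseteq> {x. Q x = d}"
      and sep: "\<And>x y. x \<in> T \<Longrightarrow> y \<in> T \<Longrightarrow> x \<noteq> y \<Longrightarrow> h \<le> dist x y"
    define u where "u = K * h / d"
    have u: "0 < u" "u < 1" using h \<open>0 < K\<close> \<open>0 < d\<close> by (auto simp: u_def field_simps)
    have sub: "(\<Union>x\<in>T. ball x (h / 2)) \<subseteq> S ((1 + u) * d) - S ((1 - u) * d)"
    proof clarify
      fix x y assume "x \<in> T" and y: "y \<in> ball x (h / 2)"
      then have "\<bar>Q y - d\<bar> \<le> K * norm (y - x)"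
        using T h by (intro lip) (auto simp: dist_norm norm_minus_commute)
      also have "\<dots> < K * h"
        using y h \<open>0 < K\<close> by (intro mult_strict_left_mono) (auto simp: dist_norm norm_minus_commute)
      finally have "\<bar>Q y - d\<bar> < u * d" using \<open>0 < d\<close> by (simp add: u_def)
      then show "y \<in> S ((1 + u) * d) - S ((1 - u) * d)"
        by (auto simp: S_def algebra_simps)
    qed
    have "real (card T) * ((h / 2) ^ (2 * ?n) * B) = (\<Sum>x\<in>T. ?\<mu> (ball x (h / 2)))"
      using h content_ball_conv_unit_ball[of "h / 2" "_ :: complex ^ 'n"] dim
      by (simp add: B_def mult.commute)
    also have "\<dots> = ?\<mu> (\<Union>x\<in>T. ball x (h / 2))"
    proof (rule measure_UNION'[symmetric])
      show "pairwise (\<lambda>i j. disjnt (ball i (h / 2)) (ball j (h / 2))) T"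
      proof (rule pairwiseI)
        fix x y assume "x \<in> T" "y \<in> T" "x \<noteq> y"
        then have "h \<le> dist x y" by (rule sep)
        then show "disjnt (ball x (h / 2)) (ball y (h / 2))"
          unfolding disjnt_iff mem_ball using dist_triangle_half_l[of x _ h y] by (fastforce simp: dist_commute)
      qed
    qed (use T in auto)
    also have "\<dots> \<le> ?\<mu> (S ((1 + u) * d) - S ((1 - u) * d))"
      using sub S_meas(1)[of "1 + u"] S_meas(1)[of "1 - u"] u
      by (intro measure_mono_fmeasurable sets_completionI_sets) (auto intro!: borel_open)
    also have "\<dots> = ?\<mu> (S ((1 + u) * d)) - ?\<mu> (S ((1 - u) * d))"
    proof (rule measurable_measure_Diff)
      have "(1 - u) * d \<le> (1 + u) * d" using u \<open>0 < d\<close> by (intro mult_right_mono) auto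
      then show "S ((1 - u) * d) \<subseteq> S ((1 + u) * d)" by (auto simp: S_def)
    qed (use S_meas(1) u in auto)
    also have "\<dots> = ((1 + u) ^ ?n - (1 - u) ^ ?n) * V"
    proof -
      have "?\<mu> (S ((1 + u) * d)) = (1 + u) ^ ?n * V" "?\<mu> (S ((1 - u) * d)) = (1 - u) ^ ?n * V"
        using u by (intro S_meas(2); simp)+
      then show ?thesis by (metis left_diff_distrib)
    qed
    also have "\<dots> \<le> (2 ^ ?n * ?n * u) * V"
    proof (rule mult_right_mono[OF _ \<open>0 \<le> V\<close>])
      \<comment> \<open>\<open>norm_power_diff\<close> compares powers of numbers of norm at most 1,
        hence the halving.\<close>
      have "norm (((1 + u) / 2) ^ ?n - ((1 - u) / 2) ^ ?n) \<le> ?n * norm ((1 + u) / 2 - (1 - u) / 2)"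
        using u by (intro norm_power_diff) auto
      then have "((1 + u) / 2) ^ ?n - ((1 - u) / 2) ^ ?n \<le> ?n * u"
        using u by (simp add: diff_divide_distrib[symmetric])
      then show "(1 + u) ^ ?n - (1 - u) ^ ?n \<le> 2 ^ ?n * ?n * u"
        by (simp add: power_divide field_simps)
    qed
    finally have "real (card T) * ((h / 2) ^ (2 * ?n) * B) \<le> 2 ^ ?n * ?n * (K * h / d) * V"
      by (simp add: u_def)
    \<comment> \<open>Each ball has volume of order h^(2n), the shell of order h; dividing by h
      leaves the exponent 2n - 1 of the boundary measure.\<close>
    then have "real (card T) * (h ^ (2 * ?n) / h) \<le> 2 ^ (2 * ?n) * (2 ^ ?n * ?n * K * V / (d * B))"
      using h \<open>0 < d\<close> \<open>0 < B\<close> by (simp add: power_divide field_simps)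
    moreover have "h powr (real (2 * ?n) - 1) = h ^ (2 * ?n) / h"
      using h by (simp add: powr_diff powr_realpow[symmetric])
    ultimately show "real (card T) * h powr (real (2 * ?n) - 1) \<le>
        2 ^ (2 * ?n) * (2 ^ ?n * ?n * K * V / (d * B))"
      by simp
  qed
qed

subsection \<open>Homogeneous expansion of holomorphic functions\<close>

lemma norm_vector_smult: "norm (c *s x) = cmod c * norm (x :: complex ^ 'n)"
  by (simp add: norm_vec_def norm_mult L2_set_right_distrib)

lemma linear_vector_smult_left: "linear (\<lambda>t :: complex. t *s (v :: complex ^ 'n))"
  by (rule linearI) (simp_all add: vec_eq_iff algebra_simps)

lemma continuous_on_complex_line: "continuous_on S (\<lambda>t :: complex. p + t *s (v :: complex ^ 'n))"
  using linear_vector_smult_left[of v]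
  by (intro continuous_on_add continuous_on_const linear_continuous_on)
    (simp add: linear_conv_bounded_linear)

text \<open>A real derivative that commutes with \<i> is complex linear, so the chain rule along an
  affine complex line yields a complex derivative. This is the passage to one-variable
  theory.\<close>

lemma holo_on_slice:
  fixes F :: "complex ^ 'n \<Rightarrow> complex"
  assumes "holo_on U F" "\<And>t. t \<in> S \<Longrightarrow> p + t *s v \<in> U"
  shows "(\<lambda>t. F (p + t *s v)) holomorphic_on S"
  unfolding holomorphic_on_def field_differentiable_def
proof
  fix t assume "t \<in> S"
  then obtain L where L: "(F has_derivative L) (at (p + t *s v))" "\<And>h. L (\<i> *s h) = \<i> * L h"
    using assms unfolding holo_on_def by blast
  have "((\<lambda>t. t *s v) has_derivative (\<lambda>t. t *s v)) (at t within S)"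
    using linear_vector_smult_left
    by (intro bounded_linear_imp_has_derivative) (simp add: linear_conv_bounded_linear)
  then have "((\<lambda>t. p + t *s v) has_derivative (\<lambda>t. t *s v)) (at t within S)"
    by (auto intro!: derivative_eq_intros)
  then have "((\<lambda>t. F (p + t *s v)) has_derivative (\<lambda>t. L (t *s v))) (at t within S)"
    using L(1) by (rule has_derivative_compose)
  moreover have "L (t *s v) = L v * t" for t
  proof -
    have "linear L" using L(1) by (rule has_derivative_linear)
    have "t *s v = Re t *\<^sub>R v + Im t *\<^sub>R (\<i> *s v)"
      by (simp add: vec_eq_iff complex_eq_iff)
    then have "L (t *s v) = Re t *\<^sub>R L v + Im t *\<^sub>R (\<i> * L v)"
      using \<open>linear L\<close> L(2) by (simp add: linear_add linear_scale)
    then show ?thesis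
      by (simp add: complex_eq_iff algebra_simps)
  qed
  ultimately show "\<exists>f'. ((\<lambda>t. F (p + t *s v)) has_field_derivative f') (at t within S)"
    unfolding has_field_derivative_def by auto
qed

lemma holo_on_const: "holo_on U (\<lambda>_. c)"
  unfolding holo_on_def by (auto intro!: exI[of _ "\<lambda>_. 0"])

lemma holo_on_coord: "holo_on U (\<lambda>z. z $ i)"
  unfolding holo_on_def
  by (intro ballI exI[of _ "\<lambda>h. h $ i"])
    (auto intro: bounded_linear_imp_has_derivative bounded_linear_vec_nth)

lemma holo_on_add:
  assumes "holo_on U f" "holo_on U g"
  shows "holo_on U (\<lambda>z. f z + g z)"
  unfolding holo_on_def
proof
  fix z assume "z \<in> U"
  then obtain L L' where "(f has_derivative L) (at z)" "\<forall>h. L (\<i> *s h) = \<i> * L h"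
    "(g has_derivative L') (at z)" "\<forall>h. L' (\<i> *s h) = \<i> * L' h"
    using assms unfolding holo_on_def by metis
  then show "\<exists>L. ((\<lambda>z. f z + g z) has_derivative L) (at z) \<and> (\<forall>h. L (\<i> *s h) = \<i> * L h)"
    by (intro exI[of _ "\<lambda>h. L h + L' h"]) (auto intro: has_derivative_add simp: distrib_left)
qed

lemma holo_on_mult:
  assumes "holo_on U f" "holo_on U g"
  shows "holo_on U (\<lambda>z. f z * g z)"
  unfolding holo_on_def
proof
  fix z assume "z \<in> U"
  then obtain L L' where "(f has_derivative L) (at z)" "\<forall>h. L (\<i> *s h) = \<i> * L h"
    "(g has_derivative L') (at z)" "\<forall>h. L' (\<i> *s h) = \<i> * L' h"
    using assms unfolding holo_on_def by metis
  then show "\<exists>L. ((\<lambda>z. f z * g z) has_derivative L) (at z) \<and> (\<forall>h. L (\<i> *s h) = \<i> * L h)"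
    by (intro exI[of _ "\<lambda>h. f z * L' h + L h * g z"] conjI has_derivative_mult) (auto simp: algebra_simps)
qed

lemma holo_on_hpoly:
  assumes "p \<in> hpoly_space N"
  shows "holo_on U p"
proof -
  have power: "holo_on U (\<lambda>z. z $ i ^ k)" for i k
    by (induction k) (auto intro: holo_on_const holo_on_mult holo_on_coord)
  have "holo_on U (\<lambda>z. \<Prod>i\<in>I. z $ i ^ \<alpha> i)" if "finite I" for I \<alpha>
    using that by (induction I) (auto intro: holo_on_const holo_on_mult power)
  then have mono: "holo_on U (hmono \<alpha>)" for \<alpha> unfolding hmono_def[abs_def] by simp
  have sum: "holo_on U (\<lambda>z. \<Sum>\<alpha>\<in>A. c \<alpha> * hmono \<alpha> z)" if "finite A" for A c
    using that by (induction A) (auto intro!: holo_on_const holo_on_mult holo_on_add mono)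
  obtain c where "\<And>z. p z = (\<Sum>\<alpha>\<in>{\<alpha>. sum \<alpha> UNIV \<le> N}. c \<alpha> * hmono \<alpha> z)"
    by (rule lincombE[OF assms[unfolded hpoly_space_eq]]) (rule that)
  then have "p = (\<lambda>z. \<Sum>\<alpha>\<in>{\<alpha>. sum \<alpha> UNIV \<le> N}. c \<alpha> * hmono \<alpha> z)" by auto
  then show ?thesis using sum[OF finite_multiindex] by simp
qed

lemma continuous_on_poly_space:
  assumes "p \<in> poly_space N"
  shows "continuous_on S p"
proof -
  obtain c where "\<And>z. p z = (\<Sum>a\<in>{(\<alpha>, \<beta>). (\<Sum>i\<in>UNIV. \<alpha> i + \<beta> i) \<le> N}. c a * rmono a z)"
    by (rule lincombE[OF assms[unfolded poly_space_eq]]) (rule that)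
  then have "p = (\<lambda>z. \<Sum>a\<in>{(\<alpha>, \<beta>). (\<Sum>i\<in>UNIV. \<alpha> i + \<beta> i) \<le> N}. c a * rmono a z)" by auto
  then show ?thesis
    unfolding rmono_def case_prod_beta by (auto intro!: continuous_intros)
qed

text \<open>Comparison with a geometric series of ratio |l|/R. It serves with R = 1 for the dilated
  expansion, and with m = k + 1 to isolate the k-th coefficient.\<close>

lemma power_series_tail_bound:
  fixes a :: "nat \<Rightarrow> complex"
  assumes "(\<lambda>i. a i * l ^ i) sums s" "\<And>i. cmod (a i) \<le> B / R ^ i" "0 < R" "cmod l < R"
  shows "cmod (s - (\<Sum>i<m. a i * l ^ i)) \<le> B * (cmod l / R) ^ m / (1 - cmod l / R)"
proof (rule norm_sums_le)
  let ?x = "cmod l / R"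
  show "(\<lambda>i. a (i + m) * l ^ (i + m)) sums (s - (\<Sum>i<m. a i * l ^ i))"
    using sums_split_initial_segment[OF assms(1)] by simp
  have "?x < 1" using assms by simp
  then have "(\<lambda>i. ?x ^ i) sums (1 / (1 - ?x))"
    using assms by (intro geometric_sums) auto
  then show "(\<lambda>i. B * ?x ^ m * ?x ^ i) sums (B * ?x ^ m / (1 - ?x))"
    using sums_mult by fastforce
  show "norm (a (i + m) * l ^ (i + m)) \<le> B * ?x ^ m * ?x ^ i" for i
  proof -
    have "norm (a (i + m) * l ^ (i + m)) \<le> B / R ^ (i + m) * cmod l ^ (i + m)"
      unfolding norm_mult norm_power using assms(2) by (intro mult_right_mono) auto
    then show ?thesis by (simp add: power_add power_divide field_simps)
  qed
qed

text \<open>The component of degree k of the Taylor expansion at \<zeta>, read off on the complex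
  line in direction w, so that only one-variable derivatives occur. That it is polynomial in w has
  to be proved.\<close>

definition hcoef :: "(complex ^ 'n \<Rightarrow> complex) \<Rightarrow> complex ^ 'n \<Rightarrow> nat \<Rightarrow> complex ^ 'n \<Rightarrow> complex" where
  "hcoef F \<zeta> k w = (deriv ^^ k) (\<lambda>l. F (\<zeta> + l *s w)) 0 / fact k"

text \<open>Replacing w by \<open>c *s w\<close> reparametrizes the line by l \<mapsto> c l, which
  multiplies the k-th derivative at 0 by \<open>c ^ k\<close>.\<close>

lemma hcoef_homogeneous:
  assumes F: "holo_on U F" and "open U" "\<zeta> \<in> U"
  shows "hcoef F \<zeta> k (c *s w) = c ^ k * hcoef F \<zeta> k w"
proof -
  let ?T = "{l. \<zeta> + l *s w \<in> U}" and ?S = "{l. \<zeta> + (c * l) *s w \<in> U}"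
  have cont': "continuous_on UNIV (\<lambda>l. \<zeta> + (c * l) *s w)"
    by (rule continuous_on_compose2[OF continuous_on_complex_line[of UNIV]]) (auto intro!: continuous_intros)
  have "open ?T" using open_vimage[OF \<open>open U\<close> continuous_on_complex_line] by (simp add: vimage_def)
  moreover have "open ?S" using open_vimage[OF \<open>open U\<close> cont'] by (simp add: vimage_def)
  moreover have "(\<lambda>l. F (\<zeta> + l *s w)) holomorphic_on ?T" by (intro holo_on_slice[OF F]) auto
  ultimately have "(deriv ^^ k) (\<lambda>l. F (\<zeta> + (c * l) *s w)) 0 =
      c ^ k * (deriv ^^ k) (\<lambda>l. F (\<zeta> + l *s w)) (c * 0)"
    using \<open>\<zeta> \<in> U\<close> by (intro higher_deriv_compose_linear[where S = ?S and T = ?T]) auto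
  then show ?thesis
    unfolding hcoef_def by (simp add: vector_smult_assoc mult.commute)
qed

lemma hcoef_bound:
  assumes "(\<lambda>l. F (\<zeta> + l *s w)) holomorphic_on ball 0 R"
    and "continuous_on (cball 0 R) (\<lambda>l. F (\<zeta> + l *s w))"
    and "0 < R" "\<And>l. cmod l \<le> R \<Longrightarrow> cmod (F (\<zeta> + l *s w)) \<le> B"
  shows "cmod (hcoef F \<zeta> k w) \<le> B / R ^ k"
  using Cauchy_inequality[OF assms(1-3), of B k] assms(4)
  by (simp add: hcoef_def norm_divide field_simps)

lemma hcoef_sums:
  assumes "(\<lambda>l. F (\<zeta> + l *s w)) holomorphic_on ball 0 R" "cmod l < R"
  shows "(\<lambda>k. hcoef F \<zeta> k w * l ^ k) sums F (\<zeta> + l *s w)"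
  using holomorphic_power_series[OF assms(1), of l] assms(2) by (simp add: hcoef_def)

text \<open>Given the claim below \<open>k\<close>, the coefficient \<open>H\<^sub>k\<close> is the locally uniform limit of
  \<open>(F (\<zeta> + l w) - \<Sum>i<k. H\<^sub>i(w) l\<^sup>i) / l\<^sup>k\<close> as \<open>l \<rightarrow> 0\<close>, hence entire in each coordinate, and by Liouville's
  theorem a polynomial in each coordinate. This needs no regularity of \<open>F\<close> beyond differentiability.\<close>
lemma hcoef_in_hpoly:
  fixes F :: "complex ^ 'n \<Rightarrow> complex"
  assumes F: "holo_on U F" and "open U" "0 < r" "cball \<zeta> r \<subseteq> U"
    and B: "\<And>z. z \<in> cball \<zeta> r \<Longrightarrow> cmod (F z) \<le> B"
  shows "hcoef F \<zeta> k \<in> hpoly_space k"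
proof (induction k rule: less_induct)
  case (less k)
  have slice: "(\<lambda>l. F (\<zeta> + l *s w)) holomorphic_on cball 0 R"
    if "R * norm w \<le> r" for R w
  proof (rule holo_on_slice[OF F])
    fix l :: complex assume "l \<in> cball 0 R"
    then have "norm (l *s w) \<le> r"
      using that mult_right_mono[of "cmod l" R "norm w"] by (simp add: norm_vector_smult)
    then show "\<zeta> + l *s w \<in> U" using \<open>cball \<zeta> r \<subseteq> U\<close> by (auto simp: dist_norm)
  qed
  have bound: "cmod (hcoef F \<zeta> i w) \<le> B / R ^ i" if "0 < R" "R * norm w \<le> r" for R w i
  proof (rule hcoef_bound)
    show "cmod (F (\<zeta> + l *s w)) \<le> B" if "cmod l \<le> R" for l
      using that \<open>R * norm w \<le> r\<close> mult_right_mono[of "cmod l" R "norm w"]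
      by (intro B) (simp add: norm_vector_smult dist_norm)
  qed (use slice[of R w] that in \<open>auto intro: holomorphic_on_imp_continuous_on holomorphic_on_subset\<close>)
  have "0 \<le> B" using B[of \<zeta>] \<open>0 < r\<close> norm_ge_zero[of "F \<zeta>"] by (simp del: norm_ge_zero)
  have sep: "\<exists>P. degree P \<le> k \<and> (\<forall>t. hcoef F \<zeta> k (upd z j t) = poly P t)" for z j
  proof -
    define e :: "complex ^ 'n" where "e = axis j 1"
    have norm_e: "norm e = 1"
      unfolding e_def by (rule norm_Basis) (simp add: axis_in_Basis_iff Basis_complex_def)
    define p where "p = upd z j 0"
    define g where "g t = hcoef F \<zeta> k (upd z j t)" for t
    have upd_eq: "upd z j t = p + t *s e" for t
      by (auto simp: vec_eq_iff p_def e_def axis_def)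
    have norm_upd: "norm (upd z j t) \<le> norm p + cmod t" for t
      unfolding upd_eq using norm_triangle_ineq[of p "t *s e"]
      by (simp add: norm_vector_smult norm_e)
    have hol_ball: "g holomorphic_on ball 0 T" if "0 < T" for T
    proof -
      \<comment> \<open>With this radius all lines in the directions \<open>upd z j t\<close>, |t|
        \<le> T, stay in the ball where F is bounded by B; the added 1 keeps the denominator
        positive.\<close>
      define R where "R = r / (norm p + T + 1)"
      have "0 < norm p + T + 1" using that norm_ge_zero[of p] by linarith
      then have "0 < R" using \<open>0 < r\<close> by (simp add: R_def)
      have R: "R * norm (upd z j t) \<le> r" if "cmod t \<le> T" for t
      proof -
        have "norm (upd z j t) \<le> norm p + T + 1" using norm_upd[of t] that by linarith
        then have "R * norm (upd z j t) \<le> R * (norm p + T + 1)"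
          using \<open>0 < R\<close> by (intro mult_left_mono) auto
        also have "\<dots> = r" using \<open>0 < norm p + T + 1\<close> by (simp add: R_def)
        finally show ?thesis .
      qed
      \<comment> \<open>A null sequence of nonzero parameters within half the radius, so that 1 / (1
        - |l|/R) is at most 2.\<close>
      define l where "l n = complex_of_real (R / 2 / real (Suc n))" for n
      have l: "l n \<noteq> 0" "cmod (l n) = R / 2 / real (Suc n)" "cmod (l n) \<le> R / 2" for n
        using \<open>0 < R\<close> by (auto simp: l_def norm_divide norm_mult field_simps simp del: of_nat_Suc)
      \<comment> \<open>The components below k are polynomials by the induction hypothesis, so
        \<open>f n\<close> is holomorphic in t; it differs from the k-th component by an error of
        order \<open>l n\<close>.\<close>
      define f where "f n t = (F (\<zeta> + l n *s upd z j t) -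
          (\<Sum>i<k. hcoef F \<zeta> i (upd z j t) * l n ^ i)) / l n ^ k" for n t
      have hol: "f n holomorphic_on cball 0 T" for n
      proof -
        have "(\<lambda>t. F ((\<zeta> + l n *s p) + t *s (l n *s e))) holomorphic_on cball 0 T"
        proof (rule holo_on_slice[OF F])
          fix t :: complex assume "t \<in> cball 0 T"
          then have "norm (l n *s upd z j t) \<le> R * norm (upd z j t)"
            unfolding norm_vector_smult using l(3)[of n] \<open>0 < R\<close> by (intro mult_right_mono) auto
          also have "\<dots> \<le> r" using R[of t] \<open>t \<in> cball 0 T\<close> by simp
          finally have "\<zeta> + l n *s upd z j t \<in> U"
            using \<open>cball \<zeta> r \<subseteq> U\<close> by (auto simp: dist_norm)
          moreover have "\<zeta> + l n *s upd z j t = (\<zeta> + l n *s p) + t *s (l n *s e)"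
            unfolding upd_eq by (simp add: vec_eq_iff algebra_simps)
          ultimately show "(\<zeta> + l n *s p) + t *s (l n *s e) \<in> U" by simp
        qed
        then have "(\<lambda>t. F (\<zeta> + l n *s upd z j t)) holomorphic_on cball 0 T"
          by (rule holomorphic_transform)
            (auto intro!: arg_cong[of _ _ F] simp: upd_eq vec_eq_iff algebra_simps)
        moreover have "(\<lambda>t. hcoef F \<zeta> i (upd z j t)) holomorphic_on cball 0 T" if "i < k" for i
          unfolding upd_eq by (rule holo_on_slice[OF holo_on_hpoly[OF less[OF that], of UNIV]]) simp
        ultimately show ?thesis
          unfolding f_def using l(1)[of n] by (intro holomorphic_intros) auto
      qed
      have est: "cmod (f n t - g t) \<le> B / R ^ k / real (Suc n)" if "cmod t \<le> T" for n t
      proof -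
        let ?x = "cmod (l n) / R"
        have "cmod (F (\<zeta> + l n *s upd z j t) - (\<Sum>i<Suc k. hcoef F \<zeta> i (upd z j t) * l n ^ i))
            \<le> B * ?x ^ Suc k / (1 - ?x)"
        proof (rule power_series_tail_bound)
          show "(\<lambda>i. hcoef F \<zeta> i (upd z j t) * l n ^ i) sums F (\<zeta> + l n *s upd z j t)"
            using slice[OF R[OF that]] l(3)[of n] \<open>0 < R\<close>
            by (intro hcoef_sums[of _ _ _ R]) (auto intro: holomorphic_on_subset)
        qed (use bound[OF \<open>0 < R\<close> R[OF that]] \<open>0 < R\<close> l(3)[of n] in auto)
        also have "\<dots> \<le> B * ?x ^ Suc k * 2"
        proof -
          have "?x \<le> 1 / 2" using l(3)[of n] \<open>0 < R\<close> by (simp add: field_simps)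
          then have "1 / (1 - ?x) \<le> 2" by (simp add: field_simps)
          then have "B * ?x ^ Suc k * (1 / (1 - ?x)) \<le> B * ?x ^ Suc k * 2"
            using \<open>0 \<le> B\<close> \<open>0 < R\<close> by (intro mult_left_mono) auto
          then show ?thesis by simp
        qed
        also have "F (\<zeta> + l n *s upd z j t) - (\<Sum>i<Suc k. hcoef F \<zeta> i (upd z j t) * l n ^ i) =
            (f n t - g t) * l n ^ k"
        proof -
          have "f n t * l n ^ k = F (\<zeta> + l n *s upd z j t) - (\<Sum>i<k. hcoef F \<zeta> i (upd z j t) * l n ^ i)"
            using l(1)[of n] by (simp add: f_def)
          then show ?thesis by (simp add: left_diff_distrib g_def)
        qed
        finally have "cmod ((f n t - g t) * l n ^ k) \<le> B * ?x ^ Suc k * 2" .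
        \<comment> \<open>Cancelling |l|^k leaves one factor |l|/R of the power k + 1, and twice
          that factor is 1/(n + 1) by the choice of \<open>l n\<close>.\<close>
        then have "cmod (f n t - g t) * cmod (l n) ^ k \<le> (B / R ^ k * (2 * ?x)) * cmod (l n) ^ k"
          unfolding norm_mult norm_power by (simp add: power_divide mult_ac)
        then have "cmod (f n t - g t) \<le> B / R ^ k * (2 * ?x)"
          by (rule mult_right_le_imp_le) (use l(1)[of n] in simp)
        also have "2 * ?x = 1 / real (Suc n)"
          unfolding l(2) using \<open>0 < R\<close> by (simp del: of_nat_Suc)
        finally show ?thesis by simp
      qed
      have "uniform_limit (cball 0 T) f g sequentially"
      proof (rule uniform_limitI)
        fix \<epsilon> :: real assume "0 < \<epsilon>"
        have "(\<lambda>n. B / R ^ k * (1 / real (Suc n))) \<longlonglongrightarrow> B / R ^ k * 0"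
          by (intro tendsto_mult tendsto_const lim_1_over_real_power LIMSEQ_Suc[OF lim_1_over_n])
        then have "\<forall>\<^sub>F n in sequentially. B / R ^ k / real (Suc n) < \<epsilon>"
          using \<open>0 < \<epsilon>\<close> by (intro order_tendstoD) auto
        then show "\<forall>\<^sub>F n in sequentially. \<forall>t\<in>cball 0 T. dist (f n t) (g t) < \<epsilon>"
        proof eventually_elim
          case (elim n)
          show ?case
          proof
            fix t :: complex assume "t \<in> cball 0 T"
            then have "cmod (f n t - g t) \<le> B / R ^ k / real (Suc n)" by (intro est) simp
            then show "dist (f n t) (g t) < \<epsilon>" unfolding dist_norm using elim by (rule le_less_trans)
          qed
        qed
      qed
      then show ?thesis
        by (rule holomorphic_uniform_limit[rotated])
          (use hol in \<open>auto intro!: always_eventually holomorphic_on_imp_continuous_on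
             intro: holomorphic_on_subset[OF hol]\<close>)
    qed
    have entire: "g holomorphic_on UNIV"
    proof -
      have "\<exists>f'. (g has_field_derivative f') (at t)" for t
        using hol_ball[of "cmod t + 1"] holomorphic_on_imp_differentiable_at[of g "ball 0 (cmod t + 1)" t]
        by (auto simp: field_differentiable_def add_nonneg_pos)
      then show ?thesis by (auto simp: holomorphic_on_def field_differentiable_def)
    qed
    \<comment> \<open>Cauchy's bound with the radius r / (2|t|), which depends on t: once |t|
      dominates the fixed part p, the direction has norm at most 2|t|.\<close>
    have growth: "cmod (g t) \<le> B * (2 / r) ^ k * cmod t ^ k" if "norm p + 1 \<le> cmod t" for t
    proof -
      have t: "0 < cmod t" using that norm_ge_zero[of p] by linarith
      have "norm (upd z j t) \<le> 2 * cmod t" using norm_upd[of t] that by linarith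
      then have "r / (2 * cmod t) * norm (upd z j t) \<le> r / (2 * cmod t) * (2 * cmod t)"
        using \<open>0 < r\<close> by (intro mult_left_mono) auto
      then have "cmod (g t) \<le> B / (r / (2 * cmod t)) ^ k"
        unfolding g_def using t \<open>0 < r\<close> by (intro bound) auto
      then show ?thesis
        using t \<open>0 < r\<close> by (simp add: power_divide power_mult_distrib field_simps)
    qed
    define P where "P = (\<Sum>i\<le>k. monom ((deriv ^^ i) g 0 / fact i) i)"
    have "degree P \<le> k"
      unfolding P_def by (intro degree_sum_le) (auto intro: order.trans[OF degree_monom_le])
    moreover have "g t = poly P t" for t
      using Liouville_polynomial[OF entire growth] by (simp add: P_def poly_sum poly_monom)
    ultimately show ?thesis by (auto simp: g_def)
  qed
  \<comment> \<open>This degree is too large; homogeneity of degree k brings it down to k.\<close>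
  have "hcoef F \<zeta> k \<in> hpoly_space (k * card (UNIV :: 'n set))"
  proof (rule separately_polynomial_imp_hpoly[OF finite _ sep])
    fix z z' :: "complex ^ 'n" assume "\<And>i. i \<in> UNIV \<Longrightarrow> z $ i = z' $ i"
    then have "z = z'" by (simp add: vec_eq_iff)
    then show "hcoef F \<zeta> k z = hcoef F \<zeta> k z'" by simp
  qed
  moreover have "\<zeta> \<in> U" using \<open>cball \<zeta> r \<subseteq> U\<close> \<open>0 < r\<close> by auto
  ultimately show ?case
    by (rule homogeneous_hpoly_degree[OF _ hcoef_homogeneous[OF F \<open>open U\<close>]])
qed

text \<open>At the contracted point \<zeta> + \<rho>(z - \<zeta>) the tail of the expansion is at
  most B \<rho>^m / (1 - \<rho>), uniformly in z, and uniform continuity on the compact closure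
  absorbs the contraction. The powers of \<rho> become the coefficients c.\<close>

lemma holomorphic_uniform_approx:
  fixes F :: "complex ^ 'n \<Rightarrow> complex"
  assumes F: "holo_on U F" "continuous_on (closure U) F" and "open U" "\<zeta> \<in> U" "bounded U"
    and circ: "\<And>z l. z \<in> closure U \<Longrightarrow> cmod l < 1 \<Longrightarrow> \<zeta> + l *s (z - \<zeta>) \<in> U"
    and circ': "\<And>z l. z \<in> closure U \<Longrightarrow> cmod l \<le> 1 \<Longrightarrow> \<zeta> + l *s (z - \<zeta>) \<in> closure U"
    and "0 < \<epsilon>"
  obtains c :: "nat \<Rightarrow> complex" and m where
    "\<And>z. z \<in> closure U \<Longrightarrow> cmod (F z - (\<Sum>k<m. c k * hcoef F \<zeta> k (z - \<zeta>))) \<le> \<epsilon>"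
proof -
  have comp: "compact (closure U)" using \<open>bounded U\<close> by simp
  obtain B where B: "\<And>z. z \<in> closure U \<Longrightarrow> cmod (F z) \<le> B"
    using compact_imp_bounded[OF compact_continuous_image[OF F(2) comp]]
    unfolding bounded_iff by blast
  obtain D where D: "0 < D" "\<And>z. z \<in> closure U \<Longrightarrow> norm (z - \<zeta>) \<le> D"
  proof -
    have "bounded ((\<lambda>z. z - \<zeta>) ` closure U)"
      using bounded_translation_minus compact_imp_bounded[OF comp] by blast
    then show ?thesis using that unfolding bounded_pos by auto
  qed
  obtain \<delta> where \<delta>: "0 < \<delta>" "\<And>z z'. z \<in> closure U \<Longrightarrow> z' \<in> closure U \<Longrightarrow> dist z' z < \<delta> \<Longrightarrow> dist (F z') (F z) < \<epsilon> / 2"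
    using compact_uniformly_continuous[OF F(2) comp] \<open>0 < \<epsilon>\<close>
    unfolding uniformly_continuous_on_def by (metis half_gt_zero)
  \<comment> \<open>As z - \<zeta> has norm at most D, the term \<delta> / (2 * D) makes every point
    move by less than \<delta>; the cap 1/2 keeps \<rho> positive.\<close>
  define \<rho> where "\<rho> = 1 - min (1/2) (\<delta> / (2 * D))"
  have \<rho>: "0 < \<rho>" "\<rho> < 1" "(1 - \<rho>) * D < \<delta>"
    using \<delta>(1) D(1) by (auto simp: \<rho>_def min_def field_simps)
  have "(\<lambda>m. B * \<rho> ^ m / (1 - \<rho>)) \<longlonglongrightarrow> B * 0 / (1 - \<rho>)"
    using \<rho> by (intro tendsto_intros LIMSEQ_power_zero) auto
  then have "\<forall>\<^sub>F m in sequentially. B * \<rho> ^ m / (1 - \<rho>) < \<epsilon> / 2"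
    using \<open>0 < \<epsilon>\<close> by (intro order_tendstoD) auto
  then obtain m where m: "B * \<rho> ^ m / (1 - \<rho>) < \<epsilon> / 2"
    by (auto simp: eventually_sequentially)
  show ?thesis
  proof (rule that[of "\<lambda>k. of_real \<rho> ^ k" m])
    fix z assume z: "z \<in> closure U"
    let ?w = "z - \<zeta>"
    have hol: "(\<lambda>l. F (\<zeta> + l *s ?w)) holomorphic_on ball 0 1"
      using circ[OF z] by (intro holo_on_slice[OF F(1)]) auto
    have cont: "continuous_on (cball 0 1) (\<lambda>l. F (\<zeta> + l *s ?w))"
      using circ'[OF z] by (intro continuous_on_compose2[OF F(2) continuous_on_complex_line]) auto
    \<comment> \<open>Cauchy's inequality at the full radius 1 uses holomorphy on the open disc and
      continuity on the closed one, which come from \<open>circ\<close> and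
      \<open>circ'\<close>.\<close>
    have "cmod (hcoef F \<zeta> k ?w) \<le> B / 1 ^ k" for k
      using circ'[OF z] B by (intro hcoef_bound[OF hol cont]) auto
    then have "cmod (F (\<zeta> + of_real \<rho> *s ?w) - (\<Sum>k<m. hcoef F \<zeta> k ?w * of_real \<rho> ^ k))
        \<le> B * (cmod (of_real \<rho>) / 1) ^ m / (1 - cmod (of_real \<rho>) / 1)"
      using \<rho> by (intro power_series_tail_bound hcoef_sums[OF hol]) auto
    also have "\<dots> < \<epsilon> / 2" using m \<rho> by simp
    finally have 1: "cmod (F (\<zeta> + of_real \<rho> *s ?w) - (\<Sum>k<m. of_real \<rho> ^ k * hcoef F \<zeta> k ?w)) < \<epsilon> / 2"
      by (simp add: mult.commute)
    have "dist (\<zeta> + of_real \<rho> *s ?w) z = norm (of_real (1 - \<rho>) *s ?w)"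
      by (simp add: dist_norm norm_minus_commute vec_eq_iff algebra_simps)
    also have "\<dots> = (1 - \<rho>) * norm ?w" using \<rho> by (simp only: norm_vector_smult norm_of_real)
    also have "\<dots> \<le> (1 - \<rho>) * D" using \<rho> D(2)[OF z] by (intro mult_left_mono) auto
    also have "\<dots> < \<delta>" by (rule \<rho>)
    finally have "cmod (F (\<zeta> + of_real \<rho> *s ?w) - F z) < \<epsilon> / 2"
      using \<delta>(2)[OF z circ'[OF z]] \<rho> by (simp add: dist_norm)
    with 1 show "cmod (F z - (\<Sum>k<m. of_real \<rho> ^ k * hcoef F \<zeta> k ?w)) \<le> \<epsilon>"
      using norm_triangle_ineq4[of "F (\<zeta> + of_real \<rho> *s ?w) - (\<Sum>k<m. of_real \<rho> ^ k * hcoef F \<zeta> k ?w)"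
        "F (\<zeta> + of_real \<rho> *s ?w) - F z"] by simp
  qed
qed

subsection \<open>Circular domains\<close>

lemma space_surface_measure [simp]: "space (surface_measure S) = S"
  by (simp add: surface_measure_def space_measure_of_conv)

lemma sigma_sets_restrict_borel:
  "sigma_sets S (sets (restrict_space borel S)) = sets (restrict_space borel S)"
  using sets.sigma_sets_eq[of "restrict_space borel S"] by (simp add: space_restrict_space)

lemma sets_surface_measure: "sets (surface_measure S) = sets (restrict_space borel S)"
proof -
  have "sets (restrict_space borel S) \<subseteq> Pow S"
    using sets.space_closed[of "restrict_space borel S"] by (simp add: space_restrict_space)
  then show ?thesis
    by (simp add: surface_measure_def sets_measure_of_conv sigma_sets_restrict_borel)
qed

lemma emeasure_surface_measure:
  fixes S :: "(complex ^ 'n) set"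
  assumes "A \<in> sets (surface_measure S)"
  shows "emeasure (surface_measure S) A =
    (if measure_space S (sets (restrict_space borel S)) (hausdorff_outer (real (2 * CARD('n)) - 1))
     then hausdorff_outer (real (2 * CARD('n)) - 1) A else 0)"
  using assms unfolding sets_surface_measure
  by (simp add: surface_measure_def emeasure_measure_of_conv sigma_sets_restrict_borel)

lemma finite_measure_surface_measure:
  fixes S :: "(complex ^ 'n) set"
  assumes "hausdorff_outer (real (2 * CARD('n)) - 1) S < \<infinity>"
  shows "finite_measure (surface_measure S)"
proof
  have "S \<in> sets (surface_measure S)" using sets.top[of "surface_measure S"] by simp
  then show "emeasure (surface_measure S) (space (surface_measure S)) \<noteq> \<infinity>"
    using assms by (auto simp: emeasure_surface_measure less_top)
qed

text \<open>The condition in \<open>emeasure_surface_measure\<close> depends on S alone, so a set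
  and its preimage fall under the same case; Hausdorff invariance applies because f maps the
  preimage within S onto the set.\<close>

lemma distr_surface_measure_isometry:
  fixes f :: "complex ^ 'n \<Rightarrow> complex ^ 'n"
  assumes iso: "\<And>x y. dist (f x) (f y) = dist x y" and "surj f" and S: "\<And>x. f x \<in> S \<longleftrightarrow> x \<in> S"
  shows "f \<in> surface_measure S \<rightarrow>\<^sub>M surface_measure S"
    and "distr (surface_measure S) (surface_measure S) f = surface_measure S"
proof -
  have "continuous_on UNIV f"
    unfolding continuous_on_iff using iso by auto
  then have "f \<in> restrict_space borel S \<rightarrow>\<^sub>M restrict_space borel S"
    using S by (intro measurable_restrict_space3 borel_measurable_continuous_onI) auto
  then show meas: "f \<in> surface_measure S \<rightarrow>\<^sub>M surface_measure S"
    using measurable_cong_sets[OF sets_surface_measure sets_surface_measure, of S S] by simp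
  show "distr (surface_measure S) (surface_measure S) f = surface_measure S"
  proof (rule measure_eqI)
    fix A assume "A \<in> sets (distr (surface_measure S) (surface_measure S) f)"
    then have A: "A \<in> sets (surface_measure S)" by simp
    then have "A \<subseteq> S" using sets.sets_into_space by fastforce
    have "f ` (f -` A \<inter> S) = A"
    proof
      show "A \<subseteq> f ` (f -` A \<inter> S)"
      proof
        fix y assume "y \<in> A"
        obtain x where "y = f x" using \<open>surj f\<close> by (rule surjE)
        with \<open>y \<in> A\<close> \<open>A \<subseteq> S\<close> S[of x] show "y \<in> f ` (f -` A \<inter> S)" by auto
      qed
    qed auto
    then have "hausdorff_outer (real (2 * CARD('n)) - 1) (f -` A \<inter> S) =
        hausdorff_outer (real (2 * CARD('n)) - 1) A"
      using hausdorff_outer_isometry[OF iso \<open>surj f\<close>] by metis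
    moreover have "f -` A \<inter> S \<in> sets (surface_measure S)"
      using measurable_sets[OF meas A] by simp
    ultimately show "emeasure (distr (surface_measure S) (surface_measure S) f) A =
        emeasure (surface_measure S) A"
      using A by (simp add: emeasure_distr[OF meas] emeasure_surface_measure)
  qed simp
qed

definition rot :: "complex ^ 'n \<Rightarrow> complex \<Rightarrow> complex ^ 'n \<Rightarrow> complex ^ 'n" where
  "rot \<zeta> l z = \<zeta> + l *s (z - \<zeta>)"

lemma rot_isometry: "cmod l = 1 \<Longrightarrow> dist (rot \<zeta> l x) (rot \<zeta> l y) = dist x y"
proof -
  assume l: "cmod l = 1"
  have "rot \<zeta> l x - rot \<zeta> l y = l *s (x - y)"
    by (simp add: rot_def vec_eq_iff algebra_simps)
  then show ?thesis unfolding dist_norm using l by (simp only: norm_vector_smult)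
qed

lemma continuous_on_rot: "continuous_on S (rot \<zeta> l)"
proof -
  have "bounded_linear ((*s) l :: complex ^ 'n \<Rightarrow> _)"
    by (rule bounded_linear_intro[of _ "cmod l"])
      (auto simp: vec_eq_iff norm_vector_smult algebra_simps)
  then show ?thesis unfolding rot_def
    by (intro continuous_intros bounded_linear.continuous_on[of "(*s) l"])
qed

lemma rot_rot: "rot \<zeta> l (rot \<zeta> l' z) = rot \<zeta> (l * l') z"
  by (simp add: rot_def vector_smult_assoc)

lemma rot_one [simp]: "rot \<zeta> 1 z = z"
  by (simp add: rot_def)

lemma surj_rot: "l \<noteq> 0 \<Longrightarrow> surj (rot \<zeta> l)"
  by (rule surjI[of _ "rot \<zeta> (inverse l)"]) (simp add: rot_rot)

text \<open>The extra factor shifts the exponents to 1, ..., degree P + 1, none divisible by n. Each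
  monomial thus sums to 0, as a geometric series whose ratio is a nontrivial n-th root of
  unity.\<close>

lemma sum_poly_roots_of_unity:
  fixes P :: "complex poly"
  assumes "degree P + 1 < n" and \<omega>: "\<omega> = exp (2 * of_real pi * \<i> / of_nat n)"
  shows "(\<Sum>m<n. poly P (\<omega> ^ m) * \<omega> ^ m) = 0"
proof -
  have \<omega>_pow: "\<omega> ^ j = exp (2 * of_real pi * \<i> * of_nat j / of_nat n)" for j
    unfolding \<omega> exp_of_nat_mult[symmetric] by (simp add: mult_ac)
  have n: "1 \<le> n" using assms by simp
  have "(\<Sum>m<n. (\<omega> ^ (j + 1)) ^ m) = 0" if "j \<le> degree P" for j
  proof -
    have "\<omega> ^ (j + 1) \<noteq> 1"
      unfolding \<omega>_pow using complex_root_unity_eq_1[OF n, of "j + 1"] assms(1) that nat_dvd_not_less[of "j + 1" n]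
      by simp
    moreover have "\<omega> ^ n = 1"
      unfolding \<omega>_pow using complex_root_unity_eq_1[OF n, of n] by simp
    then have "(\<omega> ^ (j + 1)) ^ n = 1"
      by (metis power_mult mult.commute power_one)
    ultimately show ?thesis by (simp add: geometric_sum)
  qed
  then have "(\<Sum>j\<le>degree P. coeff P j * (\<Sum>m<n. (\<omega> ^ (j + 1)) ^ m)) = 0" by simp
  also have "(\<Sum>j\<le>degree P. coeff P j * (\<Sum>m<n. (\<omega> ^ (j + 1)) ^ m)) =
      (\<Sum>m<n. \<Sum>j\<le>degree P. coeff P j * (\<omega> ^ (j + 1)) ^ m)"
    unfolding sum_distrib_left by (rule sum.swap)
  also have "\<dots> = (\<Sum>m<n. poly P (\<omega> ^ m) * \<omega> ^ m)"
    unfolding poly_altdef sum_distrib_right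
    by (intro sum.cong refl) (simp add: power_mult[symmetric] power_add[symmetric] algebra_simps)
  finally show ?thesis .
qed

text \<open>What the orthogonality argument uses of the ellipsoid. \<open>rot_interior\<close> makes
  slices through \<zeta> holomorphic on the open unit disc, \<open>rot_closure\<close> makes them
  continuous on the closed one, and \<open>rot_frontier\<close> and \<open>finite_area\<close> give
  a finite rotation-invariant boundary measure.\<close>

locale circular_domain =
  fixes \<Omega> :: "(complex ^ 'n) set" and \<zeta> :: "complex ^ 'n"
  assumes open_dom: "open \<Omega>" and center: "\<zeta> \<in> \<Omega>" and bounded_dom: "bounded \<Omega>"
    and rot_interior: "\<And>z l. z \<in> closure \<Omega> \<Longrightarrow> cmod l < 1 \<Longrightarrow> rot \<zeta> l z \<in> \<Omega>"
    and rot_closure: "\<And>z l. z \<in> closure \<Omega> \<Longrightarrow> cmod l \<le> 1 \<Longrightarrow> rot \<zeta> l z \<in> closure \<Omega>"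
    and rot_frontier: "\<And>z l. z \<in> frontier \<Omega> \<Longrightarrow> cmod l = 1 \<Longrightarrow> rot \<zeta> l z \<in> frontier \<Omega>"
    and finite_area: "hausdorff_outer (real (2 * CARD('n)) - 1) (frontier \<Omega>) < \<infinity>"
begin

abbreviation "E \<equiv> frontier \<Omega>"
abbreviation "M \<equiv> surface_measure E"

sublocale finite_measure M
  using finite_area by (rule finite_measure_surface_measure)

section \<open>The boundary inner product and finite-dimensional projection\<close>

definition ip :: "(complex ^ 'n \<Rightarrow> complex) \<Rightarrow> (complex ^ 'n \<Rightarrow> complex) \<Rightarrow> complex" where
  "ip f g = (\<integral>x. f x * cnj (g x) \<partial>M)"

lemma compact_E: "compact E"
  using bounded_dom by (rule compact_frontier_bounded)

lemma continuous_imp_measurable: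
  fixes f :: "complex ^ 'n \<Rightarrow> 'b::{second_countable_topology, real_normed_vector}"
  assumes "continuous_on E f"
  shows "f \<in> borel_measurable M"
proof -
  have "(borel_measurable M :: (complex ^ 'n \<Rightarrow> 'b) set) = borel_measurable (restrict_space borel E)"
    by (rule measurable_cong_sets[OF sets_surface_measure refl])
  then show ?thesis using borel_measurable_continuous_on_restrict[OF assms] by blast
qed

lemma continuous_imp_bounded:
  fixes f :: "complex ^ 'n \<Rightarrow> 'b::{second_countable_topology, banach}"
  assumes "continuous_on E f"
  obtains C where "0 \<le> C" "\<And>x. x \<in> E \<Longrightarrow> norm (f x) \<le> C"
proof -
  obtain C where "0 < C" "\<forall>y\<in>f ` E. norm y \<le> C"
    using compact_imp_bounded[OF compact_continuous_image[OF assms compact_E]]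
    unfolding bounded_pos by auto
  then show ?thesis using that[of C] by auto
qed

lemma continuous_imp_integrable:
  fixes f :: "complex ^ 'n \<Rightarrow> 'b::{second_countable_topology, banach}"
  assumes "continuous_on E f"
  shows "integrable M f"
proof -
  obtain C where "\<And>x. x \<in> E \<Longrightarrow> norm (f x) \<le> C"
    using continuous_imp_bounded[OF assms] by metis
  then show ?thesis
    using continuous_imp_measurable[OF assms] by (intro integrable_const_bound[of _ C]) (auto intro!: AE_I2)
qed

lemma ip_integrable:
  assumes "continuous_on E f" "continuous_on E g"
  shows "integrable M (\<lambda>x. f x * cnj (g x))"
  using assms by (intro continuous_imp_integrable continuous_intros)

lemma ip_diff_left:
  assumes "continuous_on E f" "continuous_on E f'" "continuous_on E g"
  shows "ip (\<lambda>x. f x - f' x) g = ip f g - ip f' g"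
  unfolding ip_def left_diff_distrib
  using assms by (intro Bochner_Integration.integral_diff ip_integrable)

lemma ip_add_right:
  assumes "continuous_on E f" "continuous_on E g" "continuous_on E g'"
  shows "ip f (\<lambda>x. g x + g' x) = ip f g + ip f g'"
  unfolding ip_def complex_cnj_add distrib_left
  using assms by (intro Bochner_Integration.integral_add ip_integrable)

lemma ip_cmult_left: "ip (\<lambda>x. c * f x) g = c * ip f g"
  unfolding ip_def by (simp add: mult.assoc)

lemma ip_sum_right:
  assumes "continuous_on E f" "\<And>i. i \<in> I \<Longrightarrow> continuous_on E (g i)"
  shows "ip f (\<lambda>x. \<Sum>i\<in>I. c i * g i x) = (\<Sum>i\<in>I. cnj (c i) * ip f (g i))"
proof -
  have "ip f (\<lambda>x. \<Sum>i\<in>I. c i * g i x) = (\<integral>x. (\<Sum>i\<in>I. cnj (c i) * (f x * cnj (g i x))) \<partial>M)"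
    unfolding ip_def by (simp add: sum_distrib_left mult_ac)
  also have "\<dots> = (\<Sum>i\<in>I. \<integral>x. cnj (c i) * (f x * cnj (g i x)) \<partial>M)"
    using assms ip_integrable by (intro Bochner_Integration.integral_sum integrable_mult_right) auto
  finally show ?thesis by (simp add: ip_def)
qed

text \<open>A substitute for definiteness: a continuous function of zero norm vanishes almost
  everywhere. It covers the zero denominator in the projection.\<close>

lemma ip_null_right:
  assumes "continuous_on E f" "continuous_on E g" "ip g g = 0"
  shows "ip f g = 0"
proof -
  have "complex_of_real (\<integral>x. (cmod (g x))\<^sup>2 \<partial>M) = ip g g"
    unfolding ip_def complex_norm_square[symmetric] by (rule integral_complex_of_real[symmetric])
  then have "(\<integral>x. (cmod (g x))\<^sup>2 \<partial>M) = 0" using assms(3) by simp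
  then have "AE x in M. (cmod (g x))\<^sup>2 = 0"
    using assms(2)
    by (subst (asm) integral_nonneg_eq_0_iff_AE) (auto intro!: continuous_imp_integrable continuous_intros)
  then have "AE x in M. f x * cnj (g x) = 0" by eventually_elim simp
  then show ?thesis unfolding ip_def by (rule integral_eq_zero_AE)
qed

lemma continuous_on_lincomb:
  assumes "\<And>a. a \<in> A \<Longrightarrow> continuous_on E (m a)" "q \<in> lincomb A m"
  shows "continuous_on E q"
proof -
  obtain c where "\<And>z. q z = (\<Sum>a\<in>A. c a * m a z)" using lincombE[OF assms(2)] by blast
  then have "q = (\<lambda>z. \<Sum>a\<in>A. c a * m a z)" by auto
  then show ?thesis using assms(1) by (auto intro!: continuous_intros)
qed

lemma ip_lincomb_right:
  assumes "continuous_on E f" "\<And>a. a \<in> A \<Longrightarrow> continuous_on E (m a)" "q \<in> lincomb A m"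
    and "\<And>a. a \<in> A \<Longrightarrow> ip f (m a) = 0"
  shows "ip f q = 0"
proof -
  obtain c where "\<And>z. q z = (\<Sum>a\<in>A. c a * m a z)" using lincombE[OF assms(3)] by blast
  then have "q = (\<lambda>z. \<Sum>a\<in>A. c a * m a z)" by auto
  then show ?thesis using assms(1,2,4) by (simp add: ip_sum_right)
qed

text \<open>Gram-Schmidt: the residual r is already orthogonal to the functions of A, and v is the
  part of the new function orthogonal to them, so correcting by a multiple of v settles
  \<open>m a\<close> without spoiling A.\<close>

lemma orthogonal_projection_lincomb:
  assumes "finite A" "\<And>a. a \<in> A \<Longrightarrow> continuous_on E (m a)" "continuous_on E p"
  shows "\<exists>q\<in>lincomb A m. \<forall>a\<in>A. ip (\<lambda>x. p x - q x) (m a) = 0"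
  using assms
proof (induction A arbitrary: p rule: finite_induct)
  case empty
  then show ?case by (auto intro!: bexI[of _ "\<lambda>_. 0"] lincombI)
next
  case (insert a A)
  have cont_m: "\<And>a. a \<in> A \<Longrightarrow> continuous_on E (m a)" and cont_a: "continuous_on E (m a)"
    using insert.prems by auto
  have sub: "lincomb A m \<subseteq> lincomb (insert a A) m"
    using insert.hyps by (intro lincomb_subset lincomb_gen) auto
  obtain q0 where q0: "q0 \<in> lincomb A m" "\<And>a. a \<in> A \<Longrightarrow> ip (\<lambda>x. p x - q0 x) (m a) = 0"
    using insert.IH[OF cont_m insert.prems(2)] by blast
  obtain b where b: "b \<in> lincomb A m" "\<And>a'. a' \<in> A \<Longrightarrow> ip (\<lambda>x. m a x - b x) (m a') = 0"
    using insert.IH[OF cont_m cont_a] by blast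
  define v where "v x = m a x - b x" for x
  define r where "r x = p x - q0 x" for x
  \<comment> \<open>If \<open>ip v v\<close> is 0, division yields t = 0, which is right because
    \<open>ip r v\<close> is then 0 as well.\<close>
  define t where "t = ip r v / ip v v"
  have cont_b: "continuous_on E b" "continuous_on E q0"
    using continuous_on_lincomb[OF cont_m] b(1) q0(1) by auto
  have cont: "continuous_on E v" "continuous_on E r" "continuous_on E (\<lambda>x. r x - t * v x)"
    "continuous_on E (\<lambda>x. t * v x)"
    unfolding v_def r_def using cont_b cont_a insert.prems(2) by (auto intro!: continuous_intros)
  define q where "q x = q0 x + t * v x" for x
  have diff: "(\<lambda>x. p x - q x) = (\<lambda>x. r x - t * v x)"
    by (auto simp: q_def r_def)
  have orth_A: "ip (\<lambda>x. r x - t * v x) (m a') = 0" if "a' \<in> A" for a'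
  proof -
    have "ip (\<lambda>x. r x - t * v x) (m a') = ip r (m a') - t * ip v (m a')"
      using cont cont_m[OF that] by (simp add: ip_diff_left ip_cmult_left)
    then show ?thesis using q0(2)[OF that] b(2)[OF that] by (simp add: r_def[abs_def] v_def[abs_def])
  qed
  have "ip (\<lambda>x. r x - t * v x) (m a) = 0"
  proof -
    have "ip (\<lambda>x. r x - t * v x) v = ip r v - t * ip v v"
      using cont by (simp add: ip_diff_left ip_cmult_left)
    also have "\<dots> = 0"
      using ip_null_right[OF cont(2,1)] by (cases "ip v v = 0") (auto simp: t_def)
    finally have "ip (\<lambda>x. r x - t * v x) v = 0" .
    moreover have "ip (\<lambda>x. r x - t * v x) b = 0"
      by (rule ip_lincomb_right[OF cont(3) cont_m b(1) orth_A])
    moreover have "ip (\<lambda>x. r x - t * v x) (\<lambda>x. v x + b x) =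
        ip (\<lambda>x. r x - t * v x) v + ip (\<lambda>x. r x - t * v x) b"
      using cont cont_b by (intro ip_add_right) auto
    moreover have "(\<lambda>x. v x + b x) = m a" by (auto simp: v_def)
    ultimately show ?thesis by simp
  qed
  moreover have "q \<in> lincomb (insert a A) m"
  proof -
    have "m a \<in> lincomb (insert a A) m" using insert.hyps by (intro lincomb_gen) auto
    moreover have "q0 \<in> lincomb (insert a A) m" "b \<in> lincomb (insert a A) m"
      using sub q0(1) b(1) by auto
    ultimately have "(\<lambda>x. q0 x + t * (m a x + (-1) * b x)) \<in> lincomb (insert a A) m"
      by (intro lincomb_add lincomb_cmult)
    then show ?thesis by (simp add: q_def[abs_def] v_def)
  qed
  ultimately show ?case using orth_A diff by (intro bexI[of _ q]) auto
qed

section \<open>Rotational averaging and orthogonality\<close>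

lemma ip_rot:
  assumes "cmod l = 1" "continuous_on E f" "continuous_on E g"
  shows "ip (\<lambda>x. f (rot \<zeta> l x)) (\<lambda>x. g (rot \<zeta> l x)) = ip f g"
proof -
  have "l \<noteq> 0" using assms by auto
  have iff: "rot \<zeta> l x \<in> E \<longleftrightarrow> x \<in> E" for x
    using rot_frontier[of x l] rot_frontier[of "rot \<zeta> l x" "inverse l"] assms(1) \<open>l \<noteq> 0\<close>
    by (auto simp: rot_rot norm_inverse)
  note rot = distr_surface_measure_isometry[OF rot_isometry[OF assms(1)] surj_rot[OF \<open>l \<noteq> 0\<close>] iff]
  have "ip f g = (\<integral>x. f x * cnj (g x) \<partial>distr M M (rot \<zeta> l))"
    by (simp add: ip_def rot(2))
  also have "\<dots> = ip (\<lambda>x. f (rot \<zeta> l x)) (\<lambda>x. g (rot \<zeta> l x))"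
    unfolding ip_def using assms by (intro integral_distr rot(1) continuous_imp_measurable continuous_intros)
  finally show ?thesis by simp
qed

text \<open>Averaging over the rotations by roots of unity of a sufficiently large order kills the product:
  along a circle, \<open>r\<close> only has frequencies in \<open>[-N, N]\<close>, whereas \<open>h\<close> has the single frequency \<open>k\<close>.\<close>
lemma poly_orthogonal_high_degree:
  assumes r: "r \<in> poly_space N" and h: "h \<in> hpoly_space k" and "N < k"
    and hom: "\<And>c w. h (c *s w) = c ^ k * h w"
  shows "ip r (\<lambda>z. h (z - \<zeta>)) = 0"
proof -
  \<comment> \<open>For l with l^n = 1 on the circle, \<open>cnj l ^ k\<close> becomes
    \<open>l ^ (N + 1)\<close>: N factors turn r into the polynomial P and one is left for the root
    sum. As P has degree at most 2N, it suffices that 2N + 1 < n, which is N < k.\<close>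
  define n where "n = N + k + 1"
  define \<omega> where "\<omega> = exp (2 * of_real pi * \<i> / of_nat n)"
  let ?h = "\<lambda>z. h (z - \<zeta>)"
  have norm_\<omega>: "cmod \<omega> = 1" unfolding \<omega>_def by (simp add: norm_exp_eq_Re)
  have \<omega>_n: "\<omega> ^ n = 1"
    using complex_root_unity[of n 1] by (simp add: \<omega>_def n_def)
  have cont_r: "continuous_on S r" for S by (rule continuous_on_poly_space[OF r])
  have "?h \<in> poly_space k" using hpoly_shift[OF h] hpoly_subset_poly by blast
  then have cont_h: "continuous_on S ?h" for S by (rule continuous_on_poly_space)
  have zero: "(\<Sum>m<n. r (rot \<zeta> (\<omega> ^ m) z) * cnj (?h (rot \<zeta> (\<omega> ^ m) z))) = 0" for z
  proof -
    obtain P where P: "degree P \<le> 2 * N"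
      "\<And>l. cmod l = 1 \<Longrightarrow> l ^ N * r (\<zeta> + l *s (z - \<zeta>)) = poly P l"
      using poly_space_on_circle[OF r, of \<zeta> "z - \<zeta>"] by blast
    have "r (rot \<zeta> l z) * cnj (?h (rot \<zeta> l z)) = cnj (h (z - \<zeta>)) * (poly P l * l)"
      if l: "cmod l = 1" "l ^ n = 1" for l
    proof -
      have inv: "cnj l * l = 1" using l(1) by (simp add: complex_norm_square[symmetric] mult.commute)
      have "cnj l ^ k = l ^ (N + 1)"
      proof -
        have "cnj l ^ k = cnj l ^ k * l ^ (k + (N + 1))" using l(2) by (simp add: n_def add_ac)
        also have "\<dots> = (cnj l * l) ^ k * l ^ (N + 1)"
          by (simp only: power_add power_mult_distrib mult.assoc)
        finally show ?thesis using inv by simp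
      qed
      moreover have "?h (rot \<zeta> l z) = l ^ k * h (z - \<zeta>)"
        by (simp only: rot_def add_diff_cancel_left' hom)
      ultimately have "r (rot \<zeta> l z) * cnj (?h (rot \<zeta> l z)) =
          cnj (h (z - \<zeta>)) * ((l ^ N * r (\<zeta> + l *s (z - \<zeta>))) * l)"
        by (simp add: rot_def)
      then show ?thesis unfolding P(2)[OF l(1)] .
    qed
    moreover have "cmod (\<omega> ^ m) = 1" "(\<omega> ^ m) ^ n = 1" for m
      using norm_\<omega> \<omega>_n by (simp_all add: norm_power) (metis power_mult mult.commute power_one)
    ultimately have "(\<Sum>m<n. r (rot \<zeta> (\<omega> ^ m) z) * cnj (?h (rot \<zeta> (\<omega> ^ m) z))) =
        cnj (h (z - \<zeta>)) * (\<Sum>m<n. poly P (\<omega> ^ m) * \<omega> ^ m)"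
      unfolding sum_distrib_left by simp
    also have "(\<Sum>m<n. poly P (\<omega> ^ m) * \<omega> ^ m) = 0"
      using P(1) \<open>N < k\<close> by (intro sum_poly_roots_of_unity[OF _ \<omega>_def]) (simp add: n_def)
    finally show ?thesis by simp
  qed
  \<comment> \<open>All rotated pairs have the same inner product, while the finite sum of their
    integrands vanishes at every point.\<close>
  have "of_nat n * ip r ?h = (\<Sum>m<n. ip (\<lambda>x. r (rot \<zeta> (\<omega> ^ m) x)) (\<lambda>x. ?h (rot \<zeta> (\<omega> ^ m) x)))"
    using ip_rot[OF _ cont_r cont_h] norm_\<omega> by (simp add: norm_power)
  also have "\<dots> = (\<integral>z. (\<Sum>m<n. r (rot \<zeta> (\<omega> ^ m) z) * cnj (?h (rot \<zeta> (\<omega> ^ m) z))) \<partial>M)"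
    unfolding ip_def
    by (intro Bochner_Integration.integral_sum[symmetric] ip_integrable
        continuous_on_compose2[OF cont_r[of UNIV] continuous_on_rot]
        continuous_on_compose2[OF cont_h[of UNIV] continuous_on_rot] subset_UNIV)
  also have "\<dots> = 0" using zero by simp
  finally have "of_nat n * ip r ?h = 0" .
  moreover have "n \<noteq> 0" by (simp add: n_def)
  ultimately show ?thesis by simp
qed

text \<open>The pointwise bound |y| \<le> \<eta> + |y|^2 / \<eta> takes the place of the
  Cauchy-Schwarz inequality: with squared error below \<eta>^2, both terms integrate to multiples of
  \<eta>.\<close>

lemma ip_eq_zero_by_approximation:
  assumes u: "continuous_on E u" and g: "g \<in> borel_measurable M" "integrable M (\<lambda>x. (cmod (g x))\<^sup>2)"
    and approx: "\<And>\<delta>. 0 < \<delta> \<Longrightarrow>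
      \<exists>S. continuous_on E S \<and> ip u S = 0 \<and> (\<integral>x. (cmod (g x - S x))\<^sup>2 \<partial>M) < \<delta>"
  shows "ip u g = 0"
proof -
  obtain C where C: "0 \<le> C" "\<And>x. x \<in> E \<Longrightarrow> cmod (u x) \<le> C"
    using continuous_imp_bounded[OF u] by metis
  have amgm: "cmod y \<le> \<eta> + (cmod y)\<^sup>2 / \<eta>" if "0 < \<eta>" for \<eta> y
  proof (cases "cmod y \<le> \<eta>")
    case True
    then show ?thesis using that by (simp add: add_increasing2)
  next
    case False
    then have "cmod y * \<eta> \<le> cmod y * cmod y" by (intro mult_left_mono) auto
    then have "cmod y \<le> (cmod y)\<^sup>2 / \<eta>" using that by (simp add: field_simps power2_eq_square)
    then show ?thesis using that by linarith
  qed
  have dom: "cmod (u x * cnj y) \<le> C * (\<eta> + (cmod y)\<^sup>2 / \<eta>)" if "x \<in> E" "0 < \<eta>" for x y \<eta>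
    unfolding norm_mult complex_mod_cnj
    using C that amgm[of \<eta> y] by (intro mult_mono) auto
  have int: "integrable M (\<lambda>x. u x * cnj (f x))"
    if f: "f \<in> borel_measurable M" "integrable M (\<lambda>x. (cmod (f x))\<^sup>2)" for f
  proof (rule Bochner_Integration.integrable_bound)
    show "integrable M (\<lambda>x. C * (1 + (cmod (f x))\<^sup>2 / 1))" using f(2) by auto
    have "(\<lambda>x. cnj (f x)) \<in> borel_measurable M"
      by (rule measurable_compose[OF f(1)]) (intro borel_measurable_continuous_onI continuous_intros)
    then show "(\<lambda>x. u x * cnj (f x)) \<in> borel_measurable M"
      by (intro borel_measurable_times continuous_imp_measurable[OF u])
    show "AE x in M. norm (u x * cnj (f x)) \<le> norm (C * (1 + (cmod (f x))\<^sup>2 / 1))"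
      using dom[of _ 1] C(1) by (intro AE_I2) auto
  qed
  have bound: "cmod (ip u g) \<le> C * (measure M E + 1) * \<eta>" if "0 < \<eta>" for \<eta>
  proof -
    have "0 < \<eta>\<^sup>2" using that by simp
    then obtain S where S: "continuous_on E S" "ip u S = 0" "(\<integral>x. (cmod (g x - S x))\<^sup>2 \<partial>M) < \<eta>\<^sup>2"
      using approx by blast
    have S_meas: "S \<in> borel_measurable M" using continuous_imp_measurable[OF S(1)] .
    have S_int: "integrable M (\<lambda>x. (cmod (S x))\<^sup>2)"
      using S(1) by (intro continuous_imp_integrable continuous_intros)
    have diff_meas: "(\<lambda>x. g x - S x) \<in> borel_measurable M" using g(1) S_meas by (rule borel_measurable_diff)
    \<comment> \<open>A nonintegrable function has integral 0, so the smallness of this integral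
      means something only once integrability is secured.\<close>
    have diff_int: "integrable M (\<lambda>x. (cmod (g x - S x))\<^sup>2)"
    proof (rule Bochner_Integration.integrable_bound)
      show "integrable M (\<lambda>x. 2 * (cmod (g x))\<^sup>2 + 2 * (cmod (S x))\<^sup>2)" using g(2) S_int by auto
      show "(\<lambda>x. (cmod (g x - S x))\<^sup>2) \<in> borel_measurable M" using diff_meas by measurable
      have "(cmod (y - y'))\<^sup>2 \<le> 2 * (cmod y)\<^sup>2 + 2 * (cmod y')\<^sup>2" for y y'
      proof -
        have "(cmod (y - y'))\<^sup>2 \<le> (cmod y + cmod y')\<^sup>2"
          by (intro power_mono norm_triangle_ineq4) auto
        also have "\<dots> \<le> 2 * (cmod y)\<^sup>2 + 2 * (cmod y')\<^sup>2"
          using sum_squares_bound[of "cmod y" "cmod y'"] by (simp add: power2_sum)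
        finally show ?thesis .
      qed
      then show "AE x in M. norm ((cmod (g x - S x))\<^sup>2) \<le> norm (2 * (cmod (g x))\<^sup>2 + 2 * (cmod (S x))\<^sup>2)"
        by (intro AE_I2) auto
    qed
    have "ip u g = ip u g - ip u S" using S(2) by simp
    also have "\<dots> = (\<integral>x. u x * cnj (g x - S x) \<partial>M)"
      unfolding ip_def complex_cnj_diff right_diff_distrib
      by (intro Bochner_Integration.integral_diff[symmetric] int g S_meas S_int)
    finally have "cmod (ip u g) \<le> (\<integral>x. cmod (u x * cnj (g x - S x)) \<partial>M)"
      using integral_norm_bound by metis
    also have "\<dots> \<le> (\<integral>x. C * (\<eta> + (cmod (g x - S x))\<^sup>2 / \<eta>) \<partial>M)"
    proof (rule integral_mono)
      show "integrable M (\<lambda>x. cmod (u x * cnj (g x - S x)))"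
        by (intro integrable_norm int[OF diff_meas diff_int])
      show "integrable M (\<lambda>x. C * (\<eta> + (cmod (g x - S x))\<^sup>2 / \<eta>))" using diff_int by auto
      show "cmod (u x * cnj (g x - S x)) \<le> C * (\<eta> + (cmod (g x - S x))\<^sup>2 / \<eta>)"
        if "x \<in> space M" for x
        using that \<open>0 < \<eta>\<close> by (intro dom) auto
    qed
    also have "\<dots> = C * (\<eta> * measure M E + (\<integral>x. (cmod (g x - S x))\<^sup>2 \<partial>M) / \<eta>)"
      using diff_int by (simp add: mult.commute)
    also have "\<dots> \<le> C * (\<eta> * measure M E + \<eta>\<^sup>2 / \<eta>)"
      using S(3) that C(1) by (intro mult_left_mono add_left_mono divide_right_mono) auto
    also have "\<dots> = C * (measure M E + 1) * \<eta>"
      using that by (simp add: power2_eq_square algebra_simps)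
    finally show ?thesis .
  qed
  have "cmod (ip u g) \<le> 0"
  proof (rule field_le_epsilon)
    fix e :: real assume "0 < e"
    let ?K = "C * (measure M E + 1)"
    have "0 \<le> ?K" using C(1) by simp
    then have "cmod (ip u g) \<le> ?K * (e / (?K + 1))" using bound[of "e / (?K + 1)"] \<open>0 < e\<close> by simp
    also have "\<dots> \<le> e" using \<open>0 \<le> ?K\<close> \<open>0 < e\<close> by (simp add: field_simps)
    finally show "cmod (ip u g) \<le> 0 + e" by simp
  qed
  then show ?thesis by simp
qed

text \<open>Up to degree N a shifted component lies in \<open>hpoly_space N\<close>, where u is
  orthogonal by assumption; above N the frequencies separate. Finite area turns the uniform
  approximation of F by components into one in mean square.\<close>

lemma orthogonal_to_holomorphic:
  assumes u: "u \<in> poly_space N" and orth: "\<And>q. q \<in> hpoly_space N \<Longrightarrow> ip u q = 0"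
    and F: "holo_on \<Omega> F" "continuous_on (closure \<Omega>) F"
  shows "ip u F = 0"
proof -
  have E_sub: "E \<subseteq> closure \<Omega>" by (simp add: frontier_def)
  have cont_u: "continuous_on E u" using continuous_on_poly_space[OF u] .
  have cont_F: "continuous_on E F" using F(2) E_sub by (rule continuous_on_subset)
  obtain r where r: "0 < r" "cball \<zeta> r \<subseteq> \<Omega>"
    using open_dom center open_contains_cball by blast
  have "compact (F ` cball \<zeta> r)"
    using F(2) r(2) closure_subset[of \<Omega>]
    by (intro compact_continuous_image continuous_on_subset[OF F(2)]) auto
  then obtain B where "\<forall>y\<in>F ` cball \<zeta> r. cmod y \<le> B"
    using compact_imp_bounded[of "F ` cball \<zeta> r"] unfolding bounded_iff by blast
  then have B: "\<And>z. z \<in> cball \<zeta> r \<Longrightarrow> cmod (F z) \<le> B" by blast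
  let ?H = "hcoef F \<zeta>"
  have H: "?H k \<in> hpoly_space k" for k
    by (rule hcoef_in_hpoly[OF F(1) open_dom r B])
  have H_shift: "(\<lambda>z. ?H k (z - \<zeta>)) \<in> hpoly_space k" for k
    using hpoly_shift[OF H] .
  have cont_H: "continuous_on E (\<lambda>z. ?H k (z - \<zeta>))" for k
    using H_shift[of k] hpoly_subset_poly continuous_on_poly_space by blast
  have orth_H: "ip u (\<lambda>z. ?H k (z - \<zeta>)) = 0" for k
  proof (cases "k \<le> N")
    case True
    then show ?thesis using orth H_shift hpoly_subset by blast
  next
    case False
    then show ?thesis
      by (intro poly_orthogonal_high_degree[OF u H] hcoef_homogeneous[OF F(1) open_dom center]) auto
  qed
  show ?thesis
  proof (rule ip_eq_zero_by_approximation[OF cont_u continuous_imp_measurable[OF cont_F]])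
    show "integrable M (\<lambda>x. (cmod (F x))\<^sup>2)"
      using cont_F by (intro continuous_imp_integrable continuous_intros)
    fix \<delta> :: real assume "0 < \<delta>"
    \<comment> \<open>Chosen so that \<epsilon>^2 times the area is at most \<delta> / 2; the added
      1 covers area 0.\<close>
    define \<epsilon> where "\<epsilon> = sqrt (\<delta> / (2 * (measure M E + 1)))"
    have "0 < \<epsilon>" using \<open>0 < \<delta>\<close> by (simp add: \<epsilon>_def add_nonneg_pos)
    obtain c m where c: "\<And>z. z \<in> closure \<Omega> \<Longrightarrow> cmod (F z - (\<Sum>k<m. c k * ?H k (z - \<zeta>))) \<le> \<epsilon>"
      using holomorphic_uniform_approx[OF F open_dom center bounded_dom
          rot_interior[unfolded rot_def] rot_closure[unfolded rot_def] \<open>0 < \<epsilon>\<close>] by blast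
    let ?S = "\<lambda>z. \<Sum>k<m. c k * ?H k (z - \<zeta>)"
    have cont_S: "continuous_on E ?S" using cont_H by (intro continuous_intros)
    moreover have "ip u ?S = 0"
      using cont_u cont_H by (subst ip_sum_right) (auto simp: orth_H)
    moreover have "(\<integral>x. (cmod (F x - ?S x))\<^sup>2 \<partial>M) < \<delta>"
    proof -
      have "(\<integral>x. (cmod (F x - ?S x))\<^sup>2 \<partial>M) \<le> (\<integral>x. \<epsilon>\<^sup>2 \<partial>M)"
        using cont_F cont_H c E_sub
        by (intro integral_mono continuous_imp_integrable continuous_intros power_mono) auto
      also have "\<dots> = \<delta> / 2 * (measure M E / (measure M E + 1))"
        using \<open>0 < \<delta>\<close> by (simp add: \<epsilon>_def)
      also have "\<dots> \<le> \<delta> / 2 * 1"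
        using \<open>0 < \<delta>\<close> by (intro mult_left_mono) (auto simp: add_nonneg_pos)
      finally show ?thesis using \<open>0 < \<delta>\<close> by simp
    qed
    ultimately show "\<exists>S. continuous_on E S \<and> ip u S = 0 \<and> (\<integral>x. (cmod (F x - S x))\<^sup>2 \<partial>M) < \<delta>"
      by blast
  qed
qed

lemma hpoly_in_hardy_space:
  assumes "q \<in> hpoly_space N"
  shows "q \<in> hardy_space \<Omega> (\<lambda>_. 1)"
proof -
  have cont: "continuous_on S q" for S
    using assms hpoly_subset_poly continuous_on_poly_space by blast
  have "integrable M (\<lambda>x. 1 * (cmod (q x))\<^sup>2)"
    using cont by (intro continuous_imp_integrable continuous_intros)
  then show ?thesis
    unfolding hardy_space_def L2w_def
    using continuous_imp_measurable[OF cont] cont holo_on_hpoly[OF assms]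
    by (auto intro!: exI[of _ "\<lambda>_. q"])
qed

lemma inner_w_one: "inner_w E (\<lambda>_. 1) f g = ip f g"
  by (simp add: inner_w_def ip_def)

lemma szego_maps_onto_one: "szego_maps_onto \<Omega> (\<lambda>_. 1) N"
  unfolding szego_maps_onto_def
proof (intro conjI ballI)
  fix p :: "complex ^ 'n \<Rightarrow> complex" assume p: "p \<in> poly_space N"
  let ?A = "{\<alpha> :: 'n \<Rightarrow> nat. sum \<alpha> UNIV \<le> N}"
  have cont_mono: "continuous_on E (hmono \<alpha>)" if "\<alpha> \<in> ?A" for \<alpha>
    using that hmono_in_hpoly hpoly_subset_poly continuous_on_poly_space by blast
  obtain q where q: "q \<in> hpoly_space N" "\<And>\<alpha>. \<alpha> \<in> ?A \<Longrightarrow> ip (\<lambda>x. p x - q x) (hmono \<alpha>) = 0"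
    using orthogonal_projection_lincomb[where m = hmono and A = ?A, OF finite_multiindex cont_mono
        continuous_on_poly_space[OF p]]
    unfolding hpoly_space_eq by blast
  let ?u = "\<lambda>x. p x - q x"
  \<comment> \<open>The residual stays in P_N because HP_N is contained in P_N; this makes the
    orthogonality to high degrees available for it.\<close>
  have u: "?u \<in> poly_space N"
    using pspace_add[OF p pspace_cmult[of q N "-1"]] q(1) hpoly_subset_poly by auto
  have cont_u: "continuous_on E ?u" by (rule continuous_on_poly_space[OF u])
  have orth: "ip ?u h = 0" if "h \<in> hpoly_space N" for h
    using ip_lincomb_right[OF cont_u cont_mono that[unfolded hpoly_space_eq] q(2)] .
  have "ip ?u g = 0" if g: "g \<in> hardy_space \<Omega> (\<lambda>_. 1)" for g
  proof -
    obtain F where F: "\<And>k. holo_on \<Omega> (F k)" "\<And>k. continuous_on (closure \<Omega>) (F k)"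
      "(\<lambda>k. \<integral>x. (cmod (g x - F k x))\<^sup>2 \<partial>M) \<longlonglongrightarrow> 0"
      using g unfolding hardy_space_def by auto
    have g': "g \<in> borel_measurable M" "integrable M (\<lambda>x. (cmod (g x))\<^sup>2)"
      using g unfolding hardy_space_def L2w_def by auto
    \<comment> \<open>Two approximations are stacked: g by holomorphic functions in mean square, and
      each of those by its components.\<close>
    show ?thesis
    proof (rule ip_eq_zero_by_approximation[OF cont_u g'])
      fix \<delta> :: real assume "0 < \<delta>"
      then have "\<forall>\<^sub>F k in sequentially. (\<integral>x. (cmod (g x - F k x))\<^sup>2 \<partial>M) < \<delta>"
        using F(3) by (intro order_tendstoD(2)) auto
      then obtain k where k: "(\<integral>x. (cmod (g x - F k x))\<^sup>2 \<partial>M) < \<delta>"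
        by (auto simp: eventually_sequentially)
      moreover have "ip ?u (F k) = 0"
        by (rule orthogonal_to_holomorphic[OF u orth F(1,2)])
      moreover have "continuous_on E (F k)"
        using F(2) by (rule continuous_on_subset) (simp add: frontier_def)
      ultimately show "\<exists>S. continuous_on E S \<and> ip ?u S = 0 \<and> (\<integral>x. (cmod (g x - S x))\<^sup>2 \<partial>M) < \<delta>"
        by blast
    qed
  qed
  then show "\<exists>q\<in>hpoly_space N. is_szego_proj \<Omega> (\<lambda>_. 1) p q"
    using q(1) hpoly_in_hardy_space by (auto simp: is_szego_proj_def inner_w_one)
next
  fix q :: "complex ^ 'n \<Rightarrow> complex" assume q: "q \<in> hpoly_space N"
  then have "is_szego_proj \<Omega> (\<lambda>_. 1) q q"
    using hpoly_in_hardy_space by (auto simp: is_szego_proj_def inner_w_def)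
  then show "\<exists>p\<in>poly_space N. is_szego_proj \<Omega> (\<lambda>_. 1) p q"
    using q hpoly_subset_poly by blast
qed

end

subsection \<open>Ellipsoids\<close>

lemma C_k_const: "C_k k U (\<lambda>_. c)"
  by (induction k arbitrary: c) auto

locale hermitian_ellipsoid =
  fixes a :: "real ^ 'n ^ 'n" and d :: real and \<zeta> :: "complex ^ 'n"
  assumes d_pos: "0 < d" and pos_def: "\<And>x :: real ^ 'n. x \<noteq> 0 \<Longrightarrow> 0 < x \<bullet> (a *v x)"
begin

text \<open>Two arguments are kept so that differences of Q can be split additively in
  \<open>form_diff\<close>.\<close>

definition form :: "complex ^ 'n \<Rightarrow> complex ^ 'n \<Rightarrow> real" where
  "form z w = Re (\<Sum>i\<in>UNIV. \<Sum>j\<in>UNIV. complex_of_real (a $ i $ j) * z $ i * cnj (w $ j))"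

abbreviation Q :: "complex ^ 'n \<Rightarrow> real" where "Q z \<equiv> form z z"

definition ellipsoid :: "(complex ^ 'n) set" where "ellipsoid = {z. Q (z - \<zeta>) < d}"

lemma Q_smult: "Q (l *s z) = (cmod l)\<^sup>2 * Q z"
proof -
  have "(\<Sum>i\<in>UNIV. \<Sum>j\<in>UNIV. complex_of_real (a $ i $ j) * (l *s z) $ i * cnj ((l *s z) $ j)) =
      complex_of_real ((cmod l)\<^sup>2) *
        (\<Sum>i\<in>UNIV. \<Sum>j\<in>UNIV. complex_of_real (a $ i $ j) * z $ i * cnj (z $ j))"
    unfolding complex_norm_square sum_distrib_left by (simp add: mult_ac)
  then show ?thesis unfolding form_def by simp
qed

lemma Q_scaleR: "Q (c *\<^sub>R z) = c\<^sup>2 * Q z"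
proof -
  have "c *\<^sub>R z = complex_of_real c *s z" by (simp add: vec_eq_iff complex_eq_iff)
  then show ?thesis by (simp only: Q_smult norm_of_real power2_abs)
qed

text \<open>With real coefficients the mixed products of real and imaginary parts are purely
  imaginary and drop out, so positivity passes from real to complex vectors.\<close>

lemma Q_eq_real: "Q z = (\<chi> i. Re (z $ i)) \<bullet> (a *v (\<chi> i. Re (z $ i))) +
    (\<chi> i. Im (z $ i)) \<bullet> (a *v (\<chi> i. Im (z $ i)))"
  unfolding form_def
  by (simp add: inner_vec_def matrix_vector_mult_def sum_distrib_left sum.distrib[symmetric] algebra_simps)

lemma Q_pos: "z \<noteq> 0 \<Longrightarrow> 0 < Q z"
proof -
  assume "z \<noteq> 0"
  let ?x = "\<chi> i. Re (z $ i)" and ?y = "\<chi> i. Im (z $ i)"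
  have "?x \<noteq> 0 \<or> ?y \<noteq> 0" using \<open>z \<noteq> 0\<close> by (auto simp: vec_eq_iff complex_eq_iff)
  moreover have "0 \<le> ?x \<bullet> (a *v ?x)" "0 \<le> ?y \<bullet> (a *v ?y)"
    using pos_def[of ?x] pos_def[of ?y] by (cases "?x = 0"; cases "?y = 0"; simp add: less_imp_le)+
  ultimately show ?thesis
    unfolding Q_eq_real using pos_def[of ?x] pos_def[of ?y] by linarith
qed

lemma continuous_on_Q: "continuous_on S (\<lambda>z. Q (z - c))"
  unfolding form_def by (intro continuous_intros)

text \<open>The minimum over the compact unit sphere, extended by homogeneity.\<close>

lemma Q_lower_bound:
  obtains m where "0 < m" "\<And>z. m * (norm z)\<^sup>2 \<le> Q z"
proof -
  have "sphere 0 1 \<noteq> ({} :: (complex ^ 'n) set)" by (simp add: sphere_eq_empty)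
  moreover have "continuous_on (sphere 0 1) Q" using continuous_on_Q[of _ 0] by simp
  ultimately obtain u :: "complex ^ 'n" where u: "u \<in> sphere 0 1" "\<And>v. v \<in> sphere 0 1 \<Longrightarrow> Q u \<le> Q v"
    using continuous_attains_inf[OF compact_sphere, of 0 1 Q] by blast
  show ?thesis
  proof (rule that)
    show "0 < Q u" using u(1) by (intro Q_pos) auto
    show "Q u * (norm z)\<^sup>2 \<le> Q z" for z
    proof (cases "z = 0")
      case True
      then show ?thesis using Q_scaleR[of 0 0] by simp
    next
      case False
      have "Q u \<le> Q (inverse (norm z) *\<^sub>R z)" using False by (intro u(2)) simp
      then show ?thesis using False by (simp add: Q_scaleR field_simps)
    qed
  qed
qed

lemma form_bound: "\<bar>form z w\<bar> \<le> (\<Sum>i\<in>UNIV. \<Sum>j\<in>UNIV. \<bar>a $ i $ j\<bar>) * norm z * norm w"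
proof -
  have "\<bar>form z w\<bar> \<le> cmod (\<Sum>i\<in>UNIV. \<Sum>j\<in>UNIV. complex_of_real (a $ i $ j) * z $ i * cnj (w $ j))"
    unfolding form_def by (rule abs_Re_le_cmod)
  also have "\<dots> \<le> (\<Sum>i\<in>UNIV. \<Sum>j\<in>UNIV. \<bar>a $ i $ j\<bar> * norm z * norm w)"
  proof (intro order.trans[OF norm_sum] sum_mono)
    fix i j
    show "cmod (complex_of_real (a $ i $ j) * z $ i * cnj (w $ j)) \<le> \<bar>a $ i $ j\<bar> * norm z * norm w"
      unfolding norm_mult complex_mod_cnj norm_of_real
      by (intro mult_mono Finite_Cartesian_Product.norm_nth_le) auto
  qed
  also have "\<dots> = (\<Sum>i\<in>UNIV. \<Sum>j\<in>UNIV. \<bar>a $ i $ j\<bar>) * norm z * norm w"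
    by (simp add: sum_distrib_right)
  finally show ?thesis .
qed

lemma form_diff: "Q z - Q w = form (z - w) z + form w (z - w)"
  unfolding form_def by (simp add: sum_subtractf[symmetric] sum.distrib[symmetric] algebra_simps)

lemma bounded_sublevel: "bounded {z. Q z \<le> c}"
proof -
  obtain m where m: "0 < m" "\<And>z. m * (norm z)\<^sup>2 \<le> Q z" using Q_lower_bound by blast
  have "norm z \<le> sqrt (c / m)" if "Q z \<le> c" for z
  proof (rule real_le_rsqrt)
    show "(norm z)\<^sup>2 \<le> c / m" using m(2)[of z] that m(1) by (simp add: field_simps)
  qed
  then show ?thesis unfolding bounded_iff by blast
qed

lemma level_set_finite: "hausdorff_outer (real (2 * CARD('n)) - 1) {z. Q z = d} < \<infinity>"
proof -
  obtain D where D: "0 < D" "\<And>z. Q z \<le> d \<Longrightarrow> norm z \<le> D"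
    using bounded_sublevel[of d] unfolding bounded_pos by auto
  let ?A = "\<Sum>i\<in>UNIV. \<Sum>j\<in>UNIV. \<bar>a $ i $ j\<bar>"
  have A: "0 \<le> ?A" by (intro sum_nonneg) auto
  show ?thesis
  proof (rule hausdorff_outer_homogeneous_level_set_finite)
    show "continuous_on UNIV Q" using continuous_on_Q[of _ 0] by simp
    \<comment> \<open>The two terms of \<open>form_diff\<close> contribute D + 1 and D, the bounds
      for the norms of y and x; the final 1 makes the constant positive.\<close>
    show "0 < ?A * (2 * D + 1) + 1" using A D(1) by (intro add_nonneg_pos mult_nonneg_nonneg) auto
    fix x y assume x: "Q x = d" and y: "norm (y - x) \<le> 1"
    have "norm x \<le> D" using D(2) x by simp
    moreover then have "norm y \<le> D + 1" using y norm_triangle_sub[of y x] by linarith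
    moreover have "\<bar>Q y - d\<bar> \<le> \<bar>form (y - x) y\<bar> + \<bar>form x (y - x)\<bar>"
      using form_diff[of y x] x by linarith
    moreover have "\<bar>form (y - x) y\<bar> \<le> ?A * norm (y - x) * norm y" by (rule form_bound)
    moreover have "\<bar>form x (y - x)\<bar> \<le> ?A * norm x * norm (y - x)" by (rule form_bound)
    moreover have "?A * norm (y - x) * norm y \<le> ?A * norm (y - x) * (D + 1)"
      using \<open>norm y \<le> D + 1\<close> A by (intro mult_left_mono) auto
    moreover have "?A * norm x * norm (y - x) \<le> ?A * D * norm (y - x)"
      using \<open>norm x \<le> D\<close> A by (intro mult_right_mono mult_left_mono) auto
    ultimately have "\<bar>Q y - d\<bar> \<le> ?A * norm (y - x) * (D + 1) + ?A * D * norm (y - x)" by linarith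
    also have "\<dots> \<le> (?A * (2 * D + 1) + 1) * norm (y - x)" by (simp add: algebra_simps)
    finally show "\<bar>Q y - d\<bar> \<le> (?A * (2 * D + 1) + 1) * norm (y - x)" .
  qed (use d_pos bounded_sublevel Q_scaleR in auto)
qed

lemma open_ellipsoid: "open ellipsoid"
  unfolding ellipsoid_def by (intro open_Collect_less continuous_on_Q continuous_intros)

lemma closure_ellipsoid_le: "z \<in> closure ellipsoid \<Longrightarrow> Q (z - \<zeta>) \<le> d"
proof -
  have "closed {z. Q (z - \<zeta>) \<le> d}" by (intro closed_Collect_le continuous_on_Q continuous_intros)
  then have "closure ellipsoid \<subseteq> {z. Q (z - \<zeta>) \<le> d}"
    by (rule closure_minimal[rotated]) (auto simp: ellipsoid_def)
  then show "z \<in> closure ellipsoid \<Longrightarrow> Q (z - \<zeta>) \<le> d" by auto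
qed

lemma Q_rot: "Q (rot \<zeta> l z - \<zeta>) = (cmod l)\<^sup>2 * Q (z - \<zeta>)"
  by (simp only: rot_def add_diff_cancel_left' Q_smult)

lemma frontier_ellipsoid: "frontier ellipsoid \<subseteq> {z. Q (z - \<zeta>) = d}"
  using closure_ellipsoid_le open_ellipsoid by (fastforce simp: frontier_def interior_open ellipsoid_def)

lemma circular_domain_ellipsoid: "circular_domain ellipsoid \<zeta>"
proof
  show "open ellipsoid" by (rule open_ellipsoid)
  show "\<zeta> \<in> ellipsoid" using Q_scaleR[of 0 0] d_pos by (simp add: ellipsoid_def)
  show "bounded ellipsoid"
  proof (rule bounded_subset)
    show "bounded ((+) \<zeta> ` {z. Q z \<le> d})" using bounded_sublevel by (rule bounded_translation)
    show "ellipsoid \<subseteq> (+) \<zeta> ` {z. Q z \<le> d}"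
    proof
      fix z assume "z \<in> ellipsoid"
      then show "z \<in> (+) \<zeta> ` {z. Q z \<le> d}"
        by (intro image_eqI[of _ _ "z - \<zeta>"]) (auto simp: ellipsoid_def)
    qed
  qed
  have Q_nonneg: "0 \<le> Q z" for z
    using Q_pos[of z] Q_scaleR[of 0 0] by (cases "z = 0") auto
  show "rot \<zeta> l z \<in> ellipsoid" if "z \<in> closure ellipsoid" "cmod l < 1" for z l
  proof -
    have "(cmod l)\<^sup>2 * Q (z - \<zeta>) \<le> (cmod l)\<^sup>2 * d"
      using closure_ellipsoid_le[OF that(1)] by (intro mult_left_mono) auto
    also have "\<dots> < 1 * d"
      using that(2) d_pos by (intro mult_strict_right_mono) (auto simp: power_less_one_iff abs_square_less_1)
    finally show ?thesis by (simp add: ellipsoid_def Q_rot)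
  qed
  show rot_closure: "rot \<zeta> l z \<in> closure ellipsoid" if "z \<in> closure ellipsoid" "cmod l \<le> 1" for z l
  proof -
    \<comment> \<open>It suffices to treat the open ellipsoid: a continuous map that preserves it
      carries its closure into its closure.\<close>
    have "rot \<zeta> l w \<in> ellipsoid" if "w \<in> ellipsoid" for w
    proof -
      have "(cmod l)\<^sup>2 * Q (w - \<zeta>) \<le> 1 * Q (w - \<zeta>)"
        using \<open>cmod l \<le> 1\<close> Q_nonneg by (intro mult_right_mono) (auto simp: power_le_one)
      then show ?thesis using that by (simp add: ellipsoid_def Q_rot)
    qed
    then have "rot \<zeta> l ` closure ellipsoid \<subseteq> closure ellipsoid"
      using closure_subset[of ellipsoid] by (intro image_closure_subset continuous_on_rot) auto
    then show ?thesis using that(1) by auto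
  qed
  show "rot \<zeta> l z \<in> frontier ellipsoid" if "z \<in> frontier ellipsoid" "cmod l = 1" for z l
  proof -
    have "z \<in> closure ellipsoid" using that(1) by (simp add: frontier_def)
    then have "rot \<zeta> l z \<in> closure ellipsoid" using that(2) by (intro rot_closure) auto
    \<comment> \<open>A point at level d lies outside the open ellipsoid, so within the closure it
      is a boundary point.\<close>
    moreover have "Q (rot \<zeta> l z - \<zeta>) = d"
      using that frontier_ellipsoid by (auto simp: Q_rot)
    ultimately show ?thesis
      using open_ellipsoid by (auto simp: frontier_def interior_open ellipsoid_def)
  qed
  \<comment> \<open>Moving the centre to 0 makes the form homogeneous, and translation preserves
    Hausdorff measure.\<close>
  have "frontier ellipsoid \<subseteq> (+) \<zeta> ` {z. Q z = d}"
  proof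
    fix z assume "z \<in> frontier ellipsoid"
    then show "z \<in> (+) \<zeta> ` {z. Q z = d}"
      using frontier_ellipsoid by (intro image_eqI[of _ _ "z - \<zeta>"]) auto
  qed
  then have "hausdorff_outer (real (2 * CARD('n)) - 1) (frontier ellipsoid) \<le>
      hausdorff_outer (real (2 * CARD('n)) - 1) ((+) \<zeta> ` {z. Q z = d})"
    by (rule hausdorff_outer_mono)
  then show "hausdorff_outer (real (2 * CARD('n)) - 1) (frontier ellipsoid) < \<infinity>"
    unfolding hausdorff_outer_translate using level_set_finite by (rule le_less_trans)
qed

end

theorem theorem4:
  fixes a :: "real ^ 'n ^ 'n" and d :: real and \<zeta> :: "complex ^ 'n" and \<Omega> :: "(complex ^ 'n) set"
  assumes "d > 0"
    and "transpose a = a"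
    and "\<forall>x :: real ^ 'n. x \<noteq> 0 \<longrightarrow> x \<bullet> (a *v x) > 0"
    and "\<Omega> = {z. Re (\<Sum>i\<in>UNIV. \<Sum>j\<in>UNIV. complex_of_real (a $ i $ j) * (z $ i - \<zeta> $ i) * cnj (z $ j - \<zeta> $ j)) < d}"
  shows "\<exists>\<omega> :: complex ^ 'n \<Rightarrow> real.
           smooth_on_set (frontier \<Omega>) \<omega> \<and> (\<forall>x\<in>frontier \<Omega>. \<omega> x > 0) \<and>
           (\<forall>N. szego_maps_onto \<Omega> \<omega> N)"
proof (intro exI conjI)
  interpret hermitian_ellipsoid a d \<zeta>
    using assms by unfold_locales auto
  have "\<Omega> = ellipsoid" unfolding assms(4) ellipsoid_def form_def by simp
  then interpret circular_domain \<Omega> \<zeta>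
    using circular_domain_ellipsoid by simp
  show "smooth_on_set (frontier \<Omega>) (\<lambda>_. 1)"
    unfolding smooth_on_set_def smooth_on_def by (auto intro!: exI[of _ UNIV] exI[of _ "\<lambda>_. 1"] C_k_const)
  show "\<forall>x\<in>frontier \<Omega>. 0 < (1 :: real)" by simp
  show "\<forall>N. szego_maps_onto \<Omega> (\<lambda>_. 1) N" using szego_maps_onto_one by simp
qed

end
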